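(* Any measure $\mu$ on $\mathcal{B}(\varGamma)$ can be decomposed into a sum $\mu=\mu_\rho+\mu_\sigma$ of an $H$-regular measure $\mu_\rho$ and an $H$-singular measure $\mu_\sigma$. For $\alpha\in(0,\infty)$, the spaces $L^\alpha(\mu_\rho)$ and $L^\alpha(\mu_\sigma)$ can be identified with subspaces of $L^\alpha(\mu)$ of the form $\mathbf{1}_{B_\rho}L^\alpha(\mu)$ and $\mathbf{1}_{B_\sigma}L^\alpha(\mu)$, respectively, where $B_\rho,B_\sigma\in\mathcal{B}(\varGamma)$ (the identifications being $g\mapsto\mathbf{1}_{B_\rho}g$ and $g\mapsto\mathbf{1}_{B_\sigma}g$). With these identifications, $$L^\alpha(\mu)=L^\alpha(\mu_\rho)\oplus L^\alpha(\mu_\sigma)\qquad\text{and}\qquad L^\alpha(\mu_\sigma)=\bigcap_{\tilde x\in\tilde G}C_\alpha\mathbf{P}(\tilde x),$$ where the closures $C_\alpha$ are taken in $L^\alpha(\mu)$.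
   Context: $G$ is an LCA group (locally compact abelian, Hausdorff, written additively), $H$ a closed subgroup of $G$, and $\tilde x=x+H\in\tilde G:=G/H$ for $x\in G$. $\varGamma$ is the dual group of $G$, $\langle\gamma,x\rangle$ is the value of $\gamma\in\varGamma$ at $x\in G$, and $\varLambda:=\{\gamma\in\varGamma:\langle\gamma,y\rangle=1\ \forall y\in H\}$ is the annihilator of $H$. Standing assumption: $\varLambda$ is finite or countably infinite. $\mathcal{B}(\varGamma)$ is the Borel $\sigma$-algebra of $\varGamma$; $\mathbf{1}_S$ is the indicator function of $S\subseteq\varGamma$. A "measure on $\mathcal{B}(\varGamma)$" means a finite non-negative regular measure: for all $B\in\mathcal{B}(\varGamma)$ and $\epsilon>0$ there are a compact $K$ and an open $U$ with $K\subset B\subset U$ and $\mu(U\setminus K)<\epsilon$. For $\alpha\in(0,\infty)$, $L^\alpha(\mu)$ is the metric space of ($\mu$-equivalence classes of) $\alpha$-integrable Borel functions $\varGamma\to\mathbb{C}$ (with metric given by the norm $\|f-g\|_{L^\alpha(\mu)}$ if $\alpha\ge1$ and by $\int|f-g|^\alpha d\mu$ if $\alpha<1$), and $C_\alpha\mathcal{L}$ is the closure of $\mathcal{L}\subset L^\alpha(\mu)$ in it. For non-empty $S\subseteq G$, $\mathbf{P}(S)$ is the linear space of functions $p:\varGamma\to\mathbb{C}$ that are finite sums $p(\cdot)=\sum_k a_k\langle\cdot,s_k\rangle$ with $a_k\in\mathbb{C}$, $s_k\in S$; for $x\in G$ set $\mathbf{P}(\tilde x):=\mathbf{P}(x+H)$,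 which depends only on $\tilde x$. For a given $\alpha\in(0,\infty)$, a measure $\mu$ on $\mathcal{B}(\varGamma)$ is $H$-regular if $\bigcap_{\tilde x\in\tilde G}C_\alpha\mathbf{P}(\tilde x)=\{0\}$ in $L^\alpha(\mu)$, and $H$-singular if $C_\alpha\mathbf{P}(\tilde x)=L^\alpha(\mu)$ for all $\tilde x\in\tilde G$. Both notions turn out not to depend on $\alpha$; "$H$-regular" and "$H$-singular" are understood as holding for every $\alpha\in(0,\infty)$. *)

theory Defs
  imports "HOL-Analysis.Analysis"
begin

section \<open>The dual group\<close>

typedef (overloaded) ('a::topological_ab_group_add) dual_group =
  "{\<phi> :: 'a \<Rightarrow> complex. continuous_on UNIV \<phi> \<and> (\<forall>x. norm (\<phi> x) = 1) \<and>
     (\<forall>x y. \<phi> (x + y) = \<phi> x * \<phi> y)}"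
  morphisms pairing Abs_dual_group
  by (rule exI[of _ "\<lambda>_. 1"]) simp

lemma dual_group_eqI: "(\<And>x. pairing \<gamma> x = pairing \<delta> x) \<Longrightarrow> \<gamma> = \<delta>"
  by (metis pairing_inject ext)

lemma continuous_pairing: "continuous_on UNIV (pairing \<gamma>)"
  and norm_pairing [simp]: "norm (pairing \<gamma> x) = 1"
  and pairing_add_right: "pairing \<gamma> (x + y) = pairing \<gamma> x * pairing \<gamma> y"
  using pairing[of \<gamma>] by auto

instantiation dual_group :: (topological_ab_group_add) ab_group_add
begin

definition "0 = Abs_dual_group (\<lambda>_. 1)"
definition "\<gamma> + \<delta> = Abs_dual_group (\<lambda>x. pairing \<gamma> x * pairing \<delta> x)"
definition "- \<gamma> = Abs_dual_group (\<lambda>x. inverse (pairing \<gamma> x))"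
definition "\<gamma> - \<delta> = \<gamma> + - (\<delta> :: 'a dual_group)"

lemma pairing_zero [simp]: "pairing 0 x = 1"
  unfolding zero_dual_group_def by (subst Abs_dual_group_inverse) auto

lemma pairing_plus [simp]: "pairing (\<gamma> + \<delta>) x = pairing \<gamma> x * pairing \<delta> x"
  unfolding plus_dual_group_def
  by (subst Abs_dual_group_inverse)
     (auto simp: norm_mult pairing_add_right intro!: continuous_on_mult continuous_pairing)

lemma pairing_uminus [simp]: "pairing (- \<gamma>) x = inverse (pairing \<gamma> x)"
proof -
  have "pairing \<gamma> y \<noteq> 0" for y
    using norm_pairing[of \<gamma> y] by (metis norm_zero zero_neq_one)
  then show ?thesis
    unfolding uminus_dual_group_def
    by (subst Abs_dual_group_inverse)
       (auto simp: norm_inverse pairing_add_right intro!: continuous_on_inverse continuous_pairing)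
qed

instance
proof
  fix \<gamma> \<delta> \<epsilon> :: "'a dual_group"
  show "\<gamma> + \<delta> + \<epsilon> = \<gamma> + (\<delta> + \<epsilon>)"
    by (rule dual_group_eqI) (simp add: mult.assoc)
  show "\<gamma> + \<delta> = \<delta> + \<gamma>"
    by (rule dual_group_eqI) (simp add: mult.commute)
  show "0 + \<gamma> = \<gamma>"
    by (rule dual_group_eqI) simp
  show "- \<gamma> + \<gamma> = 0"
  proof (rule dual_group_eqI)
    fix x
    have "pairing \<gamma> x \<noteq> 0"
      using norm_pairing[of \<gamma> x] by (metis norm_zero zero_neq_one)
    then show "pairing (- \<gamma> + \<gamma>) x = pairing 0 x" by simp
  qed
  show "\<gamma> - \<delta> = \<gamma> + - \<delta>"
    by (rule minus_dual_group_def)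
qed

end

text \<open>The dual group carries the compact-open topology.\<close>

instantiation dual_group :: (topological_ab_group_add) topological_space
begin

definition open_dual_group :: "'a dual_group set \<Rightarrow> bool" where
  "open_dual_group = generate_topology
     {{\<gamma>. pairing \<gamma> ` K \<subseteq> U} | K U. compact K \<and> open U}"

instance
proof
  show "open (UNIV :: 'a dual_group set)"
    unfolding open_dual_group_def by (rule generate_topology.UNIV)
  show "open (S \<inter> T)" if "open S" "open T" for S T :: "'a dual_group set"
    using that unfolding open_dual_group_def by (rule generate_topology.Int)
  show "open (\<Union> \<S>)" if "\<forall>S\<in>\<S>. open S" for \<S> :: "'a dual_group set set"
    using that unfolding open_dual_group_def by (intro generate_topology.UN) blast
qed

end

lemma open_dual_group_subbasic:
  fixes K :: "'a::topological_ab_group_add set"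
  shows "compact K \<Longrightarrow> open U \<Longrightarrow> open {\<gamma>. pairing \<gamma> ` K \<subseteq> U}"
  unfolding open_dual_group_def by (rule generate_topology.Basis) blast

lemma continuous_on_pairing_left: "continuous_on UNIV (\<lambda>\<gamma>. pairing \<gamma> x)"
proof -
  have "open ((\<lambda>\<gamma>. pairing \<gamma> x) -` U)" if "open U" for U
  proof -
    have "open {\<gamma>. pairing \<gamma> ` {x} \<subseteq> U}"
      by (rule open_dual_group_subbasic[OF compact_insert[OF compact_empty] that])
    also have "{\<gamma>. pairing \<gamma> ` {x} \<subseteq> U} = (\<lambda>\<gamma>. pairing \<gamma> x) -` U"
      by auto
    finally show ?thesis .
  qed
  then show ?thesis
    by (metis continuous_on_open_vimage inf_top_right open_UNIV)
qed

instance dual_group :: (topological_ab_group_add) t2_space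
proof
  fix \<gamma> \<delta> :: "'a dual_group"
  assume "\<gamma> \<noteq> \<delta>"
  then obtain x where "pairing \<gamma> x \<noteq> pairing \<delta> x"
    using dual_group_eqI[of \<gamma> \<delta>] by auto
  then obtain U V where UV: "open U" "open V" "pairing \<gamma> x \<in> U" "pairing \<delta> x \<in> V" "U \<inter> V = {}"
    using hausdorff[of "pairing \<gamma> x" "pairing \<delta> x"] by auto
  have "open ((\<lambda>\<gamma>. pairing \<gamma> x) -` W)" if "open W" for W
    using that continuous_on_pairing_left by (rule open_vimage)
  with UV(1,2) have "open ((\<lambda>\<gamma>. pairing \<gamma> x) -` U)" "open ((\<lambda>\<gamma>. pairing \<gamma> x) -` V)"
    by simp_all
  with UV(3-5) show "\<exists>U V. open U \<and> open V \<and> \<gamma> \<in> U \<and> \<delta> \<in> V \<and> U \<inter> V = {}"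
    by (intro exI[of _ "(\<lambda>\<gamma>. pairing \<gamma> x) -` U"] exI[of _ "(\<lambda>\<gamma>. pairing \<gamma> x) -` V"]) auto
qed

definition closed_subgroup :: "'a::topological_ab_group_add set \<Rightarrow> bool" where
  "closed_subgroup H \<longleftrightarrow>
     closed H \<and> 0 \<in> H \<and> (\<forall>x\<in>H. \<forall>y\<in>H. x + y \<in> H) \<and> (\<forall>x\<in>H. - x \<in> H)"

definition annihilator :: "'a::topological_ab_group_add set \<Rightarrow> 'a dual_group set" where
  "annihilator H = {\<gamma>. \<forall>y\<in>H. pairing \<gamma> y = 1}"

definition cosets :: "'a::topological_ab_group_add set \<Rightarrow> 'a set set" where
  "cosets H = {(\<lambda>h. x + h) ` H | x. True}"

definition trig_polys :: "'a::topological_ab_group_add set \<Rightarrow> ('a dual_group \<Rightarrow> complex) set" where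
  "trig_polys S =
     {\<lambda>\<gamma>. \<Sum>k<n. a k * pairing \<gamma> (s k) | (n::nat) a s. \<forall>k<n. s k \<in> S}"

section \<open>Finite regular Borel measures\<close>

definition regular_borel_measure :: "'b::topological_space measure \<Rightarrow> bool" where
  "regular_borel_measure M \<longleftrightarrow> sets M = sets borel \<and> finite_measure M \<and>
     (\<forall>B\<in>sets borel. \<forall>\<epsilon>>0. \<exists>K U. compact K \<and> open U \<and> K \<subseteq> B \<and> B \<subseteq> U \<and> measure M (U - K) < \<epsilon>)"

section \<open>The spaces \<open>L\<^sup>\<alpha>\<close>\<close>

text \<open>Elements of \<open>L\<^sup>\<alpha>\<close> are equivalence classes of functions modulo equality almost everywhere.
  Operations on classes are written as unions over representatives; such a union is a single
  class exactly when the operation does not depend on the representatives.\<close>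

definition ae_rel :: "'b measure \<Rightarrow> (('b \<Rightarrow> complex) \<times> ('b \<Rightarrow> complex)) set" where
  "ae_rel M = {(f, g). f \<in> borel_measurable M \<and> g \<in> borel_measurable M \<and> (AE x in M. f x = g x)}"

definition Lp_functions :: "real \<Rightarrow> 'b measure \<Rightarrow> ('b \<Rightarrow> complex) set" where
  "Lp_functions \<alpha> M = {f \<in> borel_measurable M. integrable M (\<lambda>x. norm (f x) powr \<alpha>)}"

definition Lp :: "real \<Rightarrow> 'b measure \<Rightarrow> ('b \<Rightarrow> complex) set set" where
  "Lp \<alpha> M = Lp_functions \<alpha> M // ae_rel M"

definition Lp_zero :: "'b measure \<Rightarrow> ('b \<Rightarrow> complex) set" where
  "Lp_zero M = ae_rel M `` {\<lambda>_. 0}"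

definition Lp_add :: "'b measure \<Rightarrow> ('b \<Rightarrow> complex) set \<Rightarrow> ('b \<Rightarrow> complex) set \<Rightarrow> ('b \<Rightarrow> complex) set" where
  "Lp_add M F G = (\<Union>f\<in>F. \<Union>g\<in>G. ae_rel M `` {\<lambda>x. f x + g x})"

definition Lp_scale :: "'b measure \<Rightarrow> complex \<Rightarrow> ('b \<Rightarrow> complex) set \<Rightarrow> ('b \<Rightarrow> complex) set" where
  "Lp_scale M c F = (\<Union>f\<in>F. ae_rel M `` {\<lambda>x. c * f x})"

text \<open>Multiplication by the indicator function of \<open>B\<close>. The argument \<open>F\<close> need not be a class for
  \<open>M\<close> itself: below it is also applied to classes of a smaller measure.\<close>

definition Lp_indicator :: "'b measure \<Rightarrow> 'b set \<Rightarrow> ('b \<Rightarrow> complex) set \<Rightarrow> ('b \<Rightarrow> complex) set" where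
  "Lp_indicator M B F = (\<Union>f\<in>F. ae_rel M `` {\<lambda>x. indicator B x * f x})"

definition fun_dist :: "real \<Rightarrow> 'b measure \<Rightarrow> ('b \<Rightarrow> complex) \<Rightarrow> ('b \<Rightarrow> complex) \<Rightarrow> real" where
  "fun_dist \<alpha> M f g =
     (let I = (\<integral>x. norm (f x - g x) powr \<alpha> \<partial>M) in if \<alpha> \<ge> 1 then I powr (1 / \<alpha>) else I)"

definition Lp_dist :: "real \<Rightarrow> 'b measure \<Rightarrow> ('b \<Rightarrow> complex) set \<Rightarrow> ('b \<Rightarrow> complex) set \<Rightarrow> real" where
  "Lp_dist \<alpha> M F G = fun_dist \<alpha> M (SOME f. f \<in> F) (SOME g. g \<in> G)"

definition Lp_closure :: "real \<Rightarrow> 'b measure \<Rightarrow> ('b \<Rightarrow> complex) set \<Rightarrow> ('b \<Rightarrow> complex) set set" where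
  "Lp_closure \<alpha> M A =
     Metric_space.mtopology (Lp \<alpha> M) (Lp_dist \<alpha> M) closure_of ((\<lambda>f. ae_rel M `` {f}) ` A)"

definition Lp_direct_sum ::
  "'b measure \<Rightarrow> ('b \<Rightarrow> complex) set set \<Rightarrow> ('b \<Rightarrow> complex) set set \<Rightarrow> ('b \<Rightarrow> complex) set set \<Rightarrow> bool" where
  "Lp_direct_sum M V U W \<longleftrightarrow>
     V = {Lp_add M F G | F G. F \<in> U \<and> G \<in> W} \<and> U \<inter> W = {Lp_zero M}"

text \<open>The map \<open>g \<mapsto> 1\<^sub>B g\<close> identifies \<open>L\<^sup>\<alpha>(N)\<close> with the subspace \<open>1\<^sub>B L\<^sup>\<alpha>(M)\<close> of \<open>L\<^sup>\<alpha>(M)\<close>: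
  it is a linear isometric bijection between the two.\<close>

definition Lp_identified :: "real \<Rightarrow> 'b measure \<Rightarrow> 'b measure \<Rightarrow> 'b set \<Rightarrow> bool" where
  "Lp_identified \<alpha> N M B \<longleftrightarrow>
     bij_betw (Lp_indicator M B) (Lp \<alpha> N) (Lp_indicator M B ` Lp \<alpha> M) \<and>
     (\<forall>F\<in>Lp \<alpha> N. \<forall>G\<in>Lp \<alpha> N.
        Lp_indicator M B (Lp_add N F G) = Lp_add M (Lp_indicator M B F) (Lp_indicator M B G)) \<and>
     (\<forall>c. \<forall>F\<in>Lp \<alpha> N. Lp_indicator M B (Lp_scale N c F) = Lp_scale M c (Lp_indicator M B F)) \<and>
     (\<forall>F\<in>Lp \<alpha> N. \<forall>G\<in>Lp \<alpha> N.
        Lp_dist \<alpha> M (Lp_indicator M B F) (Lp_indicator M B G) = Lp_dist \<alpha> N F G)"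

section \<open>Regular and singular measures\<close>

definition H_regular :: "'a::topological_ab_group_add set \<Rightarrow> 'a dual_group measure \<Rightarrow> bool" where
  "H_regular H M \<longleftrightarrow> (\<forall>\<alpha>>0. (\<Inter>S\<in>cosets H. Lp_closure \<alpha> M (trig_polys S)) = {Lp_zero M})"

definition H_singular :: "'a::topological_ab_group_add set \<Rightarrow> 'a dual_group measure \<Rightarrow> bool" where
  "H_singular H M \<longleftrightarrow> (\<forall>\<alpha>>0. \<forall>S\<in>cosets H. Lp_closure \<alpha> M (trig_polys S) = Lp \<alpha> M)"

section \<open>Basic facts on \<open>L\<^sup>\<alpha>\<close>\<close>

text \<open>The distance is independent of representatives and is a metric, so that \<open>Lp_closure\<close> is a
  closure in a metric space.\<close>

lemma equiv_ae_rel: "equiv (borel_measurable M) (ae_rel M)"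
proof (rule equivI)
  show "ae_rel M \<subseteq> borel_measurable M \<times> borel_measurable M"
    by (auto simp: ae_rel_def)
  show "refl_on (borel_measurable M) (ae_rel M)"
    by (rule refl_onI) (simp add: ae_rel_def)
  show "sym (ae_rel M)"
    by (rule symI) (simp add: ae_rel_def eq_commute)
  show "trans (ae_rel M)"
  proof (rule transI)
    fix f g h assume "(f, g) \<in> ae_rel M" "(g, h) \<in> ae_rel M"
    then have m: "f \<in> borel_measurable M" "h \<in> borel_measurable M"
      and ae: "AE x in M. f x = g x" "AE x in M. g x = h x"
      by (simp_all add: ae_rel_def)
    from ae have "AE x in M. f x = h x"
      by eventually_elim simp
    with m show "(f, h) \<in> ae_rel M" by (simp add: ae_rel_def)
  qed
qed

lemma Lp_functions_measurable: "f \<in> Lp_functions \<alpha> M \<Longrightarrow> f \<in> borel_measurable M"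
  by (simp add: Lp_functions_def)

lemma fun_dist_cong_AE:
  assumes "(f, f') \<in> ae_rel M" "(g, g') \<in> ae_rel M"
  shows "fun_dist \<alpha> M f g = fun_dist \<alpha> M f' g'"
proof -
  have m: "f \<in> borel_measurable M" "f' \<in> borel_measurable M"
      "g \<in> borel_measurable M" "g' \<in> borel_measurable M"
    and "AE x in M. f x = f' x" "AE x in M. g x = g' x"
    using assms by (auto simp: ae_rel_def)
  have "(\<integral>x. norm (f x - g x) powr \<alpha> \<partial>M) = (\<integral>x. norm (f' x - g' x) powr \<alpha> \<partial>M)"
    by (rule integral_cong_AE) (use m \<open>AE x in M. f x = f' x\<close> \<open>AE x in M. g x = g' x\<close> in auto)
  then show ?thesis by (simp add: fun_dist_def)
qed

lemma Lp_dist_class: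
  assumes "f \<in> borel_measurable M" "g \<in> borel_measurable M"
  shows "Lp_dist \<alpha> M (ae_rel M `` {f}) (ae_rel M `` {g}) = fun_dist \<alpha> M f g"
proof -
  have "(SOME h. h \<in> ae_rel M `` {k}) \<in> ae_rel M `` {k}" if "k \<in> borel_measurable M" for k
    by (rule someI[of _ k]) (use that in \<open>auto simp: ae_rel_def\<close>)
  then have "(k, SOME h. h \<in> ae_rel M `` {k}) \<in> ae_rel M" if "k \<in> borel_measurable M" for k
    using that by blast
  then show ?thesis
    unfolding Lp_dist_def using fun_dist_cong_AE assms by metis
qed

lemma powr_add_le_add:
  fixes a b \<alpha> :: real
  assumes "a \<ge> 0" "b \<ge> 0" "0 < \<alpha>" "\<alpha> \<le> 1"
  shows "(a + b) powr \<alpha> \<le> a powr \<alpha> + b powr \<alpha>"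
proof (cases "a + b = 0")
  case False
  then have pos: "a + b > 0" using assms by linarith
  have *: "c * (a + b) powr \<alpha> \<le> (c * (a + b)) powr \<alpha>" if "0 \<le> c" "c \<le> 1" for c
  proof -
    have "c \<le> c powr \<alpha>"
      using powr_mono'[of \<alpha> 1 c] that assms by simp
    then show ?thesis
      using pos that by (simp add: powr_mult mult_right_mono)
  qed
  have "(a + b) powr \<alpha> = (a / (a + b)) * (a + b) powr \<alpha> + (b / (a + b)) * (a + b) powr \<alpha>"
    using pos by (simp flip: distrib_right add_divide_distrib)
  also have "\<dots> \<le> (a / (a + b) * (a + b)) powr \<alpha> + (b / (a + b) * (a + b)) powr \<alpha>"
    using assms pos by (intro add_mono *) auto
  finally show ?thesis using pos by simp
qed (use assms in auto)

lemma powr_convex_nonneg: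
  fixes a b w \<alpha> :: real
  assumes "a \<ge> 0" "b \<ge> 0" "0 \<le> w" "w \<le> 1" "\<alpha> \<ge> 1"
  shows "((1 - w) * a + w * b) powr \<alpha> \<le> (1 - w) * a powr \<alpha> + w * b powr \<alpha>"
proof -
  have *: "(c * d) powr \<alpha> \<le> c * d powr \<alpha>" if "0 \<le> c" "c \<le> 1" "0 \<le> d" for c d :: real
  proof -
    have "c powr \<alpha> \<le> c"
      using powr_mono'[of 1 \<alpha> c] that assms by simp
    then show ?thesis
      using that by (simp add: powr_mult mult_right_mono)
  qed
  consider "a = 0" | "b = 0" | "a > 0" "b > 0" using assms by linarith
  then show ?thesis
  proof cases
    case 3
    then show ?thesis
      using convex_onD[OF powr_convex[OF assms(5)], of w a b] assms by simp
  qed (use * assms in auto)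
qed

lemma norm_add_powr_le_convex:
  fixes u v :: complex
  assumes "s > 0" "t > 0" "\<alpha> \<ge> 1"
  shows "norm (u + v) powr \<alpha> \<le> (s + t) powr \<alpha> *
    (s / (s + t) * (norm u powr \<alpha> / s powr \<alpha>) + t / (s + t) * (norm v powr \<alpha> / t powr \<alpha>))"
proof -
  have "norm (u + v) powr \<alpha> \<le> (norm u + norm v) powr \<alpha>"
    using assms by (intro powr_mono2) (auto simp: norm_triangle_ineq)
  also have "norm u + norm v = (s + t) * (s / (s + t) * (norm u / s) + t / (s + t) * (norm v / t))"
    using assms by (simp add: distrib_left)
  also have "\<dots> powr \<alpha> = (s + t) powr \<alpha> * (s / (s + t) * (norm u / s) + t / (s + t) * (norm v / t)) powr \<alpha>"
    using assms by (intro powr_mult)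
  also have "\<dots> \<le> (s + t) powr \<alpha> *
      (s / (s + t) * (norm u / s) powr \<alpha> + t / (s + t) * (norm v / t) powr \<alpha>)"
  proof (rule mult_left_mono)
    have 1: "1 - t / (s + t) = s / (s + t)" using assms by (simp add: field_simps)
    show "(s / (s + t) * (norm u / s) + t / (s + t) * (norm v / t)) powr \<alpha>
        \<le> s / (s + t) * (norm u / s) powr \<alpha> + t / (s + t) * (norm v / t) powr \<alpha>"
      using powr_convex_nonneg[of "norm u / s" "norm v / t" "t / (s + t)" \<alpha>] assms
      unfolding 1 by simp
  qed simp
  finally show ?thesis using assms by (simp add: powr_divide)
qed

lemma Lp_functions_add:
  assumes f: "f \<in> Lp_functions \<alpha> M" and g: "g \<in> Lp_functions \<alpha> M" and "\<alpha> > 0"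
  shows "(\<lambda>x. f x + g x) \<in> Lp_functions \<alpha> M"
proof -
  have [measurable]: "f \<in> borel_measurable M" "g \<in> borel_measurable M"
    and int: "integrable M (\<lambda>x. norm (f x) powr \<alpha>)" "integrable M (\<lambda>x. norm (g x) powr \<alpha>)"
    using f g by (auto simp: Lp_functions_def)
  have "norm (f x + g x) powr \<alpha> \<le> 2 powr \<alpha> * (norm (f x) powr \<alpha> + norm (g x) powr \<alpha>)" for x
  proof -
    let ?m = "max (norm (f x)) (norm (g x))"
    have "norm (f x + g x) \<le> 2 * ?m"
      using norm_triangle_ineq[of "f x" "g x"] by linarith
    then have "norm (f x + g x) powr \<alpha> \<le> (2 * ?m) powr \<alpha>"
      using \<open>\<alpha> > 0\<close> by (intro powr_mono2) auto
    also have "\<dots> = 2 powr \<alpha> * ?m powr \<alpha>" by (simp add: powr_mult)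
    also have "\<dots> \<le> 2 powr \<alpha> * (norm (f x) powr \<alpha> + norm (g x) powr \<alpha>)"
      by (intro mult_left_mono) (auto simp: max_def)
    finally show ?thesis .
  qed
  then have le: "norm (norm (f x + g x) powr \<alpha>)
      \<le> norm (2 powr \<alpha> * (norm (f x) powr \<alpha> + norm (g x) powr \<alpha>))" for x
    unfolding real_norm_def abs_of_nonneg[OF powr_ge_zero]
    by (rule order_trans[OF _ abs_ge_self])
  have "integrable M (\<lambda>x. norm (f x + g x) powr \<alpha>)"
  proof (rule Bochner_Integration.integrable_bound)
    show "integrable M (\<lambda>x. 2 powr \<alpha> * (norm (f x) powr \<alpha> + norm (g x) powr \<alpha>))"
      by (intro integrable_mult_right Bochner_Integration.integrable_add int)
    show "(\<lambda>x. norm (f x + g x) powr \<alpha>) \<in> borel_measurable M"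
      by measurable
  qed (rule AE_I2, rule le)
  then show ?thesis by (simp add: Lp_functions_def)
qed

lemma Lp_functions_diff:
  assumes "f \<in> Lp_functions \<alpha> M" "g \<in> Lp_functions \<alpha> M" "\<alpha> > 0"
  shows "(\<lambda>x. f x - g x) \<in> Lp_functions \<alpha> M"
  using Lp_functions_add[OF assms(1) _ assms(3), of "\<lambda>x. - g x"] assms(2)
  by (simp add: Lp_functions_def)

lemma Minkowski_integral:
  assumes f: "f \<in> Lp_functions \<alpha> M" and g: "g \<in> Lp_functions \<alpha> M" and \<alpha>: "\<alpha> \<ge> 1"
  shows "(\<integral>x. norm (f x + g x) powr \<alpha> \<partial>M) powr (1 / \<alpha>) \<le>
    (\<integral>x. norm (f x) powr \<alpha> \<partial>M) powr (1 / \<alpha>) + (\<integral>x. norm (g x) powr \<alpha> \<partial>M) powr (1 / \<alpha>)"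
proof (rule field_le_epsilon)
  fix e :: real assume "e > 0"
  have \<alpha>0: "\<alpha> > 0" using \<alpha> by simp
  define s where "s = (\<integral>x. norm (f x) powr \<alpha> \<partial>M) powr (1 / \<alpha>) + e / 2"
  define t where "t = (\<integral>x. norm (g x) powr \<alpha> \<partial>M) powr (1 / \<alpha>) + e / 2"
  have st: "s > 0" "t > 0"
    using \<open>e > 0\<close> by (auto simp: s_def t_def intro!: add_nonneg_pos)
  have bound: "I \<le> (I powr (1 / \<alpha>) + e / 2) powr \<alpha>" if "I \<ge> 0" for I
  proof -
    have "I = (I powr (1 / \<alpha>)) powr \<alpha>" using that \<alpha>0 by (simp add: powr_powr)
    also have "\<dots> \<le> (I powr (1 / \<alpha>) + e / 2) powr \<alpha>"
      using \<alpha>0 \<open>e > 0\<close> by (intro powr_mono2) auto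
    finally show ?thesis .
  qed
  have int: "integrable M (\<lambda>x. norm (f x) powr \<alpha>)" "integrable M (\<lambda>x. norm (g x) powr \<alpha>)"
    using f g by (auto simp: Lp_functions_def)
  have intfg: "integrable M (\<lambda>x. norm (f x + g x) powr \<alpha>)"
    using Lp_functions_add[OF f g \<alpha>0] by (simp add: Lp_functions_def)
  have le1: "(\<integral>x. norm (f x) powr \<alpha> \<partial>M) / s powr \<alpha> \<le> 1"
      "(\<integral>x. norm (g x) powr \<alpha> \<partial>M) / t powr \<alpha> \<le> 1"
    using bound[of "\<integral>x. norm (f x) powr \<alpha> \<partial>M", folded s_def]
      bound[of "\<integral>x. norm (g x) powr \<alpha> \<partial>M", folded t_def] st
    by (simp_all add: divide_le_eq)
  have "(\<integral>x. norm (f x + g x) powr \<alpha> \<partial>M) \<le> (\<integral>x. (s + t) powr \<alpha> *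
      (s / (s + t) * (norm (f x) powr \<alpha> / s powr \<alpha>) +
       t / (s + t) * (norm (g x) powr \<alpha> / t powr \<alpha>)) \<partial>M)"
    by (intro integral_mono intfg norm_add_powr_le_convex st \<alpha>) (auto simp: int)
  also have "\<dots> = (s + t) powr \<alpha> *
      (s / (s + t) * ((\<integral>x. norm (f x) powr \<alpha> \<partial>M) / s powr \<alpha>) +
       t / (s + t) * ((\<integral>x. norm (g x) powr \<alpha> \<partial>M) / t powr \<alpha>))"
    using int by simp
  also have "\<dots> \<le> (s + t) powr \<alpha> * (s / (s + t) * 1 + t / (s + t) * 1)"
    by (intro mult_left_mono add_mono le1) (use st in auto)
  also have "\<dots> = (s + t) powr \<alpha>"
    using st by (simp flip: add_divide_distrib)
  finally have "(\<integral>x. norm (f x + g x) powr \<alpha> \<partial>M) powr (1 / \<alpha>) \<le> ((s + t) powr \<alpha>) powr (1 / \<alpha>)"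
    using \<alpha>0 by (intro powr_mono2) auto
  also have "\<dots> = s + t" using \<alpha>0 st by (simp add: powr_powr)
  finally show "(\<integral>x. norm (f x + g x) powr \<alpha> \<partial>M) powr (1 / \<alpha>) \<le>
      (\<integral>x. norm (f x) powr \<alpha> \<partial>M) powr (1 / \<alpha>) + (\<integral>x. norm (g x) powr \<alpha> \<partial>M) powr (1 / \<alpha>) + e"
    by (simp add: s_def t_def)
qed

lemma fun_dist_triangle:
  assumes f: "f \<in> Lp_functions \<alpha> M" and g: "g \<in> Lp_functions \<alpha> M"
    and h: "h \<in> Lp_functions \<alpha> M" and \<alpha>: "\<alpha> > 0"
  shows "fun_dist \<alpha> M f h \<le> fun_dist \<alpha> M f g + fun_dist \<alpha> M g h"
proof (cases "\<alpha> \<ge> 1")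
  case True
  then show ?thesis
    using Minkowski_integral[OF Lp_functions_diff[OF f g \<alpha>] Lp_functions_diff[OF g h \<alpha>]]
    by (simp add: fun_dist_def)
next
  case False
  have int: "integrable M (\<lambda>x. norm (f x - g x) powr \<alpha>)" "integrable M (\<lambda>x. norm (g x - h x) powr \<alpha>)"
      "integrable M (\<lambda>x. norm (f x - h x) powr \<alpha>)"
    using Lp_functions_diff[OF f g \<alpha>] Lp_functions_diff[OF g h \<alpha>] Lp_functions_diff[OF f h \<alpha>]
    by (auto simp: Lp_functions_def)
  have "norm (f x - h x) powr \<alpha> \<le> norm (f x - g x) powr \<alpha> + norm (g x - h x) powr \<alpha>" for x
  proof -
    have "norm (f x - h x) \<le> norm (f x - g x) + norm (g x - h x)"
      using norm_triangle_ineq[of "f x - g x" "g x - h x"] by simp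
    then have "norm (f x - h x) powr \<alpha> \<le> (norm (f x - g x) + norm (g x - h x)) powr \<alpha>"
      using \<alpha> by (intro powr_mono2) auto
    also have "\<dots> \<le> norm (f x - g x) powr \<alpha> + norm (g x - h x) powr \<alpha>"
      using False \<alpha> by (intro powr_add_le_add) auto
    finally show ?thesis .
  qed
  then have "(\<integral>x. norm (f x - h x) powr \<alpha> \<partial>M) \<le>
      (\<integral>x. norm (f x - g x) powr \<alpha> + norm (g x - h x) powr \<alpha> \<partial>M)"
    using int by (intro integral_mono) auto
  then show ?thesis
    using False int by (simp add: fun_dist_def)
qed

lemma fun_dist_eq_0_iff:
  assumes f: "f \<in> Lp_functions \<alpha> M" and g: "g \<in> Lp_functions \<alpha> M" and \<alpha>: "\<alpha> > 0"
  shows "fun_dist \<alpha> M f g = 0 \<longleftrightarrow> (f, g) \<in> ae_rel M"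
proof -
  have "integrable M (\<lambda>x. norm (f x - g x) powr \<alpha>)"
    using Lp_functions_diff[OF f g \<alpha>] by (auto simp: Lp_functions_def)
  then have "(\<integral>x. norm (f x - g x) powr \<alpha> \<partial>M) = 0 \<longleftrightarrow> (AE x in M. norm (f x - g x) powr \<alpha> = 0)"
    by (intro integral_nonneg_eq_0_iff_AE) auto
  then show ?thesis
    using f g by (auto simp: fun_dist_def Let_def ae_rel_def Lp_functions_def)
qed

lemma Metric_space_Lp:
  assumes "\<alpha> > 0"
  shows "Metric_space (Lp \<alpha> M) (Lp_dist \<alpha> M)"
proof
  fix F G
  show "0 \<le> Lp_dist \<alpha> M F G"
    by (auto simp: Lp_dist_def fun_dist_def Let_def)
  show "Lp_dist \<alpha> M F G = Lp_dist \<alpha> M G F"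
    by (simp add: Lp_dist_def fun_dist_def norm_minus_commute)
next
  fix F G assume "F \<in> Lp \<alpha> M" "G \<in> Lp \<alpha> M"
  then obtain f g where "f \<in> Lp_functions \<alpha> M" "g \<in> Lp_functions \<alpha> M"
      "F = ae_rel M `` {f}" "G = ae_rel M `` {g}"
    by (auto simp: Lp_def elim!: quotientE)
  then show "Lp_dist \<alpha> M F G = 0 \<longleftrightarrow> F = G"
    using assms by (simp add: Lp_dist_class Lp_functions_measurable fun_dist_eq_0_iff
        eq_equiv_class_iff[OF equiv_ae_rel])
next
  fix F G K assume "F \<in> Lp \<alpha> M" "G \<in> Lp \<alpha> M" "K \<in> Lp \<alpha> M"
  then obtain f g k where "f \<in> Lp_functions \<alpha> M" "g \<in> Lp_functions \<alpha> M" "k \<in> Lp_functions \<alpha> M"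
      "F = ae_rel M `` {f}" "G = ae_rel M `` {g}" "K = ae_rel M `` {k}"
    by (auto simp: Lp_def elim!: quotientE)
  then show "Lp_dist \<alpha> M F K \<le> Lp_dist \<alpha> M F G + Lp_dist \<alpha> M G K"
    using assms by (simp add: Lp_dist_class Lp_functions_measurable fun_dist_triangle)
qed

end

theory Submission
  imports Defs
begin

text \<open>Write \<open>\<Lambda>\<close> for the annihilator of \<open>H\<close>. Trigonometric polynomials with frequencies in \<open>H\<close> are
  \<open>\<Lambda>\<close>-periodic, and those with frequencies in \<open>x + H\<close> are multiplied by \<open>\<langle>\<kappa>, x\<rangle>\<close> under translation by
  \<open>\<kappa> \<in> \<Lambda>\<close>. These relations pass to limits almost everywhere, so a class in all the closures satisfies
  \<open>f(\<gamma> + \<kappa>) = \<langle>\<kappa>, x\<rangle> f(\<gamma>)\<close> for every \<open>x\<close>, as long as \<open>\<gamma>\<close> and \<open>\<gamma> + \<kappa>\<close> avoid a null set that depends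
  on \<open>x\<close>. A nonzero \<open>\<kappa>\<close> takes a value other than \<open>1\<close> at some \<open>x\<close>; comparing this relation with the one
  for \<open>x = 0\<close> gives \<open>f(\<gamma>) = 0\<close>. Since \<open>\<Lambda>\<close> is countable, one null set serves all \<open>\<kappa>\<close>, and hence \<open>f\<close>
  vanishes almost everywhere off a set whose translates by nonzero elements of \<open>\<Lambda>\<close> are null
  (\<open>approximable_all_cosets_support\<close>).

  Conversely, let \<open>B\<close> be a Borel set with null translates. Up to a null set no point of the space is
  congruent modulo \<open>\<Lambda>\<close> to a different point of \<open>B\<close>, so for a Borel set \<open>A \<subseteq> B\<close> there are compact
  sets \<open>K \<subseteq> A\<close> and \<open>L\<close> disjoint from \<open>A\<close> that fill up almost all the mass, such that no difference of
  a point of \<open>K\<close> and a point of \<open>L\<close> lies in \<open>\<Lambda>\<close>. By the very definition of the annihilator such points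
  are separated by some \<open>h \<in> H\<close>, and the Stone-Weierstrass theorem on a power of the circle yields a
  polynomial with values in \<open>[0, 1]\<close> that is near \<open>1\<close> on \<open>K\<close> and near \<open>0\<close> on \<open>L\<close>
  (\<open>trig_poly_separation\<close>). Thus the indicator of \<open>A\<close>, and with it every element of \<open>L\<^sup>\<alpha>\<close> supported in
  \<open>B\<close>, lies in the closure for \<open>H\<close>; multiplication by a character moves this to the other cosets
  (\<open>approximable_coset_of_supported\<close>).

  Sets with null translates are closed under countable unions, so among them there is a largest one
  up to null sets, by exhaustion. Taking it for \<open>B\<^sub>\<sigma>\<close>, both halves together say that the intersection of
  the closures is \<open>1\<^sub>B L\<^sup>\<alpha>\<close> with \<open>B = B\<^sub>\<sigma>\<close> (\<open>Inter_Lp_closure_trig_polys\<close>). The restriction of the measure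
  to \<open>B\<^sub>\<sigma>\<close> is singular because it is carried by a set with null translates. Its restriction to the
  complement \<open>B\<^sub>\<rho>\<close> is regular because maximality of \<open>B\<^sub>\<sigma>\<close> makes every set with null translates null
  for that restriction.\<close>

section \<open>Translations and trigonometric polynomials on the dual group\<close>

text \<open>A compact-open neighbourhood only records an image inclusion, which translation does not preserve.
  So \<open>K\<close> is cut into finitely many compact pieces on which \<open>\<gamma>\<close> is nearly constant: subbasic conditions
  on the pieces force \<open>\<delta>\<close> to be uniformly close to \<open>\<gamma>\<close> on \<open>K\<close>, and multiplication by the unimodular
  value of \<open>\<kappa>\<close> is an isometry.\<close>

lemma open_dual_group_translate:
  fixes \<gamma> \<kappa> :: "'a::topological_ab_group_add dual_group"
  assumes K: "compact K" and U: "open U" and sub: "pairing (\<gamma> + \<kappa>) ` K \<subseteq> U"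
  shows "\<exists>V. open V \<and> \<gamma> \<in> V \<and> (\<forall>\<delta>\<in>V. pairing (\<delta> + \<kappa>) ` K \<subseteq> U)"
proof -
  have comp: "compact (pairing \<delta> ` K)" for \<delta> :: "'a dual_group"
    by (intro compact_continuous_image K) (rule continuous_on_subset[OF continuous_pairing], simp)
  obtain e where e: "e > 0" "(\<Union>x\<in>pairing (\<gamma> + \<kappa>) ` K. ball x e) \<subseteq> U"
    using compact_subset_open_imp_ball_epsilon_subset[OF comp U sub] by blast
  have "e / 3 > 0" using e by simp
  then obtain C where C: "finite C" "pairing \<gamma> ` K \<subseteq> (\<Union>c\<in>C. ball c (e / 3))"
    using comp[of \<gamma>] unfolding compact_eq_totally_bounded by meson
  define Kc where "Kc c = K \<inter> pairing \<gamma> -` cball c (e / 3)" for c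
  define V where "V = (\<Inter>c\<in>C. {\<delta>. pairing \<delta> ` Kc c \<subseteq> ball c (e / 2)})"
  have "compact (Kc c)" for c
    unfolding Kc_def by (intro compact_Int_closed K closed_vimage continuous_pairing) auto
  then have "open V"
    unfolding V_def by (intro open_INT C(1) ballI open_dual_group_subbasic) auto
  moreover have "\<gamma> \<in> V"
    using e(1) by (auto simp: V_def Kc_def)
  moreover have "pairing (\<delta> + \<kappa>) x \<in> U" if \<delta>: "\<delta> \<in> V" and x: "x \<in> K" for \<delta> x
  proof -
    obtain c where c: "c \<in> C" "dist c (pairing \<gamma> x) < e / 3"
      using C(2) x by (auto simp: subset_eq)
    then have "dist c (pairing \<delta> x) < e / 2"
      using \<delta> x by (auto simp: V_def Kc_def subset_eq)
    then have "dist (pairing \<gamma> x) (pairing \<delta> x) < e"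
      using c(2) e(1) dist_triangle3[of "pairing \<gamma> x" "pairing \<delta> x" c] by linarith
    then have "dist (pairing (\<gamma> + \<kappa>) x) (pairing (\<delta> + \<kappa>) x) < e"
      by (simp add: dist_norm norm_mult flip: left_diff_distrib)
    then show ?thesis using e(2) x by (auto simp: subset_eq)
  qed
  ultimately show ?thesis by blast
qed

lemma continuous_on_dual_group_translate:
  fixes \<kappa> :: "'a::topological_ab_group_add dual_group"
  shows "continuous_on UNIV (\<lambda>\<gamma>. \<gamma> + \<kappa>)"
proof -
  have "open ((\<lambda>\<gamma>. \<gamma> + \<kappa>) -` S)" if "open S" for S :: "'a dual_group set"
  proof -
    have "generate_topology {{\<gamma> :: 'a dual_group. pairing \<gamma> ` K \<subseteq> U} | K U. compact K \<and> open U} S"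
      using that by (simp add: open_dual_group_def)
    then show ?thesis
    proof (induction rule: generate_topology.induct)
      case (UN \<S>)
      then show ?case by (auto simp: vimage_Union)
    next
      case (Basis S)
      then obtain K U where KU: "compact K" "open U" "S = {\<gamma>. pairing \<gamma> ` K \<subseteq> U}" by blast
      show ?case
        unfolding open_subopen[of "_ -` S"]
      proof
        fix \<gamma> assume "\<gamma> \<in> (\<lambda>\<gamma>. \<gamma> + \<kappa>) -` S"
        then obtain V where "open V" "\<gamma> \<in> V" "\<forall>\<delta>\<in>V. pairing (\<delta> + \<kappa>) ` K \<subseteq> U"
          using open_dual_group_translate[OF KU(1,2), of \<gamma> \<kappa>] KU(3) by auto
        then show "\<exists>T. open T \<and> \<gamma> \<in> T \<and> T \<subseteq> (\<lambda>\<gamma>. \<gamma> + \<kappa>) -` S"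
          using KU(3) by blast
      qed
    qed (auto simp: vimage_Int)
  qed
  then show ?thesis by (simp add: continuous_on_open_vimage)
qed

lemma sets_borel_dual_group_translate:
  fixes B :: "'a::topological_ab_group_add dual_group set"
  assumes "B \<in> sets borel"
  shows "(\<lambda>\<gamma>. \<gamma> + \<kappa>) -` B \<in> sets borel"
  using measurable_sets[OF borel_measurable_continuous_onI[OF continuous_on_dual_group_translate] assms]
  by simp

lemma pairing_zero_right [simp]: "pairing \<gamma> 0 = 1"
proof -
  have "pairing \<gamma> 0 \<noteq> 0"
    using norm_pairing[of \<gamma> 0] by (metis norm_zero zero_neq_one)
  then show ?thesis using pairing_add_right[of \<gamma> 0 0] by simp
qed

lemma pairing_mult_cnj: "pairing \<gamma> x * cnj (pairing \<gamma> x) = 1"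
  by (simp add: complex_norm_square[symmetric])

lemma pairing_minus_right: "pairing \<gamma> (- x) = cnj (pairing \<gamma> x)"
proof -
  have "pairing \<gamma> x * pairing \<gamma> (- x) = 1"
    by (simp flip: pairing_add_right)
  then show ?thesis
    using inverse_unique pairing_mult_cnj by metis
qed

lemma pairing_diff: "pairing (\<gamma> - \<delta>) x = pairing \<gamma> x * cnj (pairing \<delta> x)"
  using inverse_unique[OF pairing_mult_cnj[of \<delta> x]]
  by (simp add: diff_conv_add_uminus del: add_uminus_conv_diff)

lemma trig_polys_zero: "(\<lambda>_. 0) \<in> trig_polys S"
  unfolding trig_polys_def by (rule CollectI) (intro exI[of _ "0::nat"], simp)

lemma trig_polys_add_term:
  assumes "p \<in> trig_polys S" "s \<in> S"
  shows "(\<lambda>\<gamma>. p \<gamma> + c * pairing \<gamma> s) \<in> trig_polys S"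
proof -
  obtain n :: nat and a t where p: "p = (\<lambda>\<gamma>. \<Sum>k<n. a k * pairing \<gamma> (t k))" "\<forall>k<n. t k \<in> S"
    using assms(1) unfolding trig_polys_def by blast
  show ?thesis
    unfolding trig_polys_def
    by (rule CollectI, rule exI[of _ "Suc n"], rule exI[of _ "a(n := c)"], rule exI[of _ "t(n := s)"])
       (use p assms(2) in \<open>auto simp: less_Suc_eq intro!: ext sum.cong\<close>)
qed

text \<open>Together with \<open>trig_polys_zero\<close> and \<open>trig_polys_add_term\<close> this presents \<open>trig_polys S\<close> as an
  inductively generated linear span, which hides the indexing of the sums.\<close>

lemma trig_polys_induct [consumes 1, case_names zero add_term]:
  assumes "p \<in> trig_polys S"
    and "P (\<lambda>_. 0)"
    and "\<And>p c s. p \<in> trig_polys S \<Longrightarrow> P p \<Longrightarrow> s \<in> S \<Longrightarrow> P (\<lambda>\<gamma>. p \<gamma> + c * pairing \<gamma> s)"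
  shows "P p"
proof -
  obtain n :: nat and a t where p: "p = (\<lambda>\<gamma>. \<Sum>k<n. a k * pairing \<gamma> (t k))" "\<forall>k<n. t k \<in> S"
    using assms(1) unfolding trig_polys_def by blast
  have "m \<le> n \<Longrightarrow> P (\<lambda>\<gamma>. \<Sum>k<m. a k * pairing \<gamma> (t k))" for m
  proof (induction m)
    case (Suc m)
    have "(\<lambda>\<gamma>. \<Sum>k<m. a k * pairing \<gamma> (t k)) \<in> trig_polys S"
      unfolding trig_polys_def using p(2) Suc.prems by (intro CollectI exI conjI[OF refl]) auto
    then show ?case using assms(3)[of _ "t m" "a m"] Suc p(2) by simp
  qed (use assms(2) in simp)
  then show ?thesis using p(1) by blast
qed

lemma trig_polys_add:
  assumes "p \<in> trig_polys S" "q \<in> trig_polys S"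
  shows "(\<lambda>\<gamma>. p \<gamma> + q \<gamma>) \<in> trig_polys S"
  using assms(2)
proof (induction rule: trig_polys_induct)
  case (add_term q c s)
  then show ?case
    using trig_polys_add_term[of "\<lambda>\<gamma>. p \<gamma> + q \<gamma>" S s c] by (simp add: add.assoc)
qed (use assms(1) in simp)

lemma trig_polys_mult_character:
  assumes "p \<in> trig_polys S" "\<And>s. s \<in> S \<Longrightarrow> x + s \<in> T"
  shows "(\<lambda>\<gamma>. c * pairing \<gamma> x * p \<gamma>) \<in> trig_polys T"
  using assms(1)
proof (induction rule: trig_polys_induct)
  case (add_term p d s)
  then show ?case
    using trig_polys_add_term[of "\<lambda>\<gamma>. c * pairing \<gamma> x * p \<gamma>" T "x + s" "c * d"] assms(2)
    by (simp add: algebra_simps pairing_add_right)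
qed (simp add: trig_polys_zero)

lemma trig_polys_character: "s \<in> S \<Longrightarrow> (\<lambda>\<gamma>. c * pairing \<gamma> s) \<in> trig_polys S"
  using trig_polys_add_term[OF trig_polys_zero, of s S c] by simp

lemma trig_polys_scale: "p \<in> trig_polys S \<Longrightarrow> (\<lambda>\<gamma>. c * p \<gamma>) \<in> trig_polys S"
  using trig_polys_mult_character[of p S 0 S c] by simp

lemma trig_polys_mult:
  assumes "p \<in> trig_polys S" "q \<in> trig_polys S" "\<And>s t. s \<in> S \<Longrightarrow> t \<in> S \<Longrightarrow> s + t \<in> S"
  shows "(\<lambda>\<gamma>. p \<gamma> * q \<gamma>) \<in> trig_polys S"
  using assms(2)
proof (induction rule: trig_polys_induct)
  case (add_term q c s)
  then have "(\<lambda>\<gamma>. p \<gamma> * q \<gamma> + c * pairing \<gamma> s * p \<gamma>) \<in> trig_polys S"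
    by (intro trig_polys_add trig_polys_mult_character[OF assms(1)]) (auto simp: assms(3))
  then show ?case by (simp add: algebra_simps)
qed (simp add: trig_polys_zero)

lemma continuous_on_trig_polys: "p \<in> trig_polys S \<Longrightarrow> continuous_on UNIV p"
  by (induction rule: trig_polys_induct) (auto intro!: continuous_intros continuous_on_pairing_left)

lemma bounded_trig_polys: "p \<in> trig_polys S \<Longrightarrow> \<exists>C. \<forall>\<gamma>. norm (p \<gamma>) \<le> C"
proof (induction rule: trig_polys_induct)
  case (add_term p c s)
  then obtain C where "\<forall>\<gamma>. norm (p \<gamma>) \<le> C" by blast
  then have "norm (p \<gamma> + c * pairing \<gamma> s) \<le> C + norm c" for \<gamma>
    by (intro order_trans[OF norm_triangle_ineq] add_mono) (auto simp: norm_mult)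
  then show ?case by blast
qed auto

lemma trig_polys_coset_translate:
  assumes "p \<in> trig_polys ((\<lambda>h. x + h) ` H)" "\<kappa> \<in> annihilator H"
  shows "p (\<gamma> + \<kappa>) = pairing \<kappa> x * p \<gamma>"
  using assms(1)
proof (induction rule: trig_polys_induct)
  case (add_term p c s)
  then obtain h where "s = x + h" "pairing \<kappa> h = 1"
    using assms(2) by (auto simp: annihilator_def)
  then show ?case using add_term by (simp add: pairing_add_right algebra_simps)
qed simp

section \<open>Separation of compact sets modulo the annihilator\<close>

text \<open>The Stone-Weierstrass theorem is applied on a product of circles indexed by the whole group, a
  possibly uncountable index type; this needs the product topology to be Hausdorff for arbitrary index
  types. The weaker separation axioms come first, so that the instances stay consistent along the
  subclass order.\<close>

lemma open_fun_coordinate_vimage: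
  "open W \<Longrightarrow> open ((\<lambda>h::'a \<Rightarrow> 'b::topological_space. h x) -` W)"
  by (rule open_vimage) simp_all

instance "fun" :: (type, t0_space) t0_space
proof
  fix f g :: "'a \<Rightarrow> 'b"
  assume "f \<noteq> g"
  then obtain x where "f x \<noteq> g x" by auto
  then obtain U where "open U" "\<not> (f x \<in> U \<longleftrightarrow> g x \<in> U)"
    using t0_space_class.t0_space by metis
  then show "\<exists>U. open U \<and> \<not> (f \<in> U \<longleftrightarrow> g \<in> U)"
    by (intro exI[of _ "(\<lambda>h. h x) -` U"]) (auto intro: open_fun_coordinate_vimage)
qed

instance "fun" :: (type, t1_space) t1_space
proof
  fix f g :: "'a \<Rightarrow> 'b"
  assume "f \<noteq> g"
  then obtain x where "f x \<noteq> g x" by auto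
  then obtain U where "open U" "f x \<in> U" "g x \<notin> U"
    using t1_space_class.t1_space by metis
  then show "\<exists>U. open U \<and> f \<in> U \<and> g \<notin> U"
    by (intro exI[of _ "(\<lambda>h. h x) -` U"]) (auto intro: open_fun_coordinate_vimage)
qed

instance "fun" :: (type, t2_space) t2_space
proof
  fix f g :: "'a \<Rightarrow> 'b"
  assume "f \<noteq> g"
  then obtain x where "f x \<noteq> g x" by auto
  then obtain U V where "open U" "open V" "f x \<in> U" "g x \<in> V" "U \<inter> V = {}"
    using hausdorff by metis
  then show "\<exists>U V. open U \<and> open V \<and> f \<in> U \<and> g \<in> V \<and> U \<inter> V = {}"
    by (intro exI[of _ "(\<lambda>h. h x) -` U"] exI[of _ "(\<lambda>h. h x) -` V"])
       (auto intro: open_fun_coordinate_vimage)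
qed

text \<open>Evaluation at the points of \<open>H\<close> maps the dual group into a product of circles, which is compact.
  The continuous functions on this product that pull back to elements of \<open>trig_polys H\<close> form an algebra
  that separates the points of the product, and the images of \<open>K\<close> and \<open>L\<close> are disjoint compact sets. Working
  on the whole product, and not only on the image of \<open>K \<union> L\<close>, gives the bounds \<open>0 \<le> r \<le> 1\<close> on the
  whole dual group; these control the integral over the rest of the space.\<close>

lemma trig_poly_separation:
  fixes H :: "'g::topological_ab_group_add set"
  assumes H: "closed_subgroup H" and K: "compact K" and L: "compact L"
    and sep: "\<And>\<gamma> \<delta>. \<gamma> \<in> K \<Longrightarrow> \<delta> \<in> L \<Longrightarrow> \<gamma> - \<delta> \<notin> annihilator H" and e: "0 < e" "e < 1"
  obtains r :: "'g dual_group \<Rightarrow> real" where "(\<lambda>\<gamma>. of_real (r \<gamma>)) \<in> trig_polys H"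
    "\<And>\<gamma>. 0 \<le> r \<gamma>" "\<And>\<gamma>. r \<gamma> \<le> 1" "\<And>\<gamma>. \<gamma> \<in> K \<Longrightarrow> 1 - e < r \<gamma>" "\<And>\<gamma>. \<gamma> \<in> L \<Longrightarrow> r \<gamma> < e"
proof -
  have H0: "0 \<in> H" and Hadd: "\<And>s t. s \<in> H \<Longrightarrow> t \<in> H \<Longrightarrow> s + t \<in> H"
    and Huminus: "\<And>s. s \<in> H \<Longrightarrow> - s \<in> H"
    using H by (auto simp: closed_subgroup_def)
  \<comment> \<open>Coordinates outside \<open>H\<close> are held at \<open>1\<close>, so that only coordinates in \<open>H\<close> have to be separated.\<close>
  define S :: "('g \<Rightarrow> complex) set" where "S = PiE UNIV (\<lambda>h. if h \<in> H then sphere 0 1 else {1})"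
  define \<Phi> where "\<Phi> \<gamma> h = (if h \<in> H then pairing \<gamma> h else 1)" for \<gamma> :: "'g dual_group" and h
  define R where "R = {r :: ('g \<Rightarrow> complex) \<Rightarrow> real. continuous_on S r \<and>
    (\<lambda>\<gamma>. of_real (r (\<Phi> \<gamma>))) \<in> trig_polys H}"
  have \<Phi>S: "\<Phi> \<gamma> \<in> S" for \<gamma>
    by (auto simp: S_def \<Phi>_def)
  have \<Phi>cont: "continuous_on X \<Phi>" for X
  proof (rule continuous_on_coordinatewise_then_product)
    show "continuous_on X (\<lambda>\<gamma>. \<Phi> \<gamma> h)" for h
      using continuous_on_subset[OF continuous_on_pairing_left, of X h]
      by (cases "h \<in> H") (auto simp: \<Phi>_def)
  qed
  have coord: "(\<lambda>x. f (x h)) \<in> R" if h: "h \<in> H" and f: "f = Re \<or> f = Im" for f h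
  proof -
    have "continuous_on S (\<lambda>x::'g \<Rightarrow> complex. x h)"
      by (rule continuous_on_subset[OF continuous_on_product_coordinates]) simp
    then have "continuous_on S (\<lambda>x. f (x h))"
      using f by (auto intro: continuous_intros)
    moreover have "(\<lambda>\<gamma>. of_real (f (\<Phi> \<gamma> h))) \<in> trig_polys H"
    proof -
      have comb: "(\<lambda>\<gamma>. c * pairing \<gamma> h + d * pairing \<gamma> (- h)) \<in> trig_polys H" for c d
        by (intro trig_polys_add trig_polys_character h Huminus)
      have "(\<lambda>\<gamma>. of_real (Re (\<Phi> \<gamma> h))) = (\<lambda>\<gamma>. 1/2 * pairing \<gamma> h + 1/2 * pairing \<gamma> (- h))"
        "(\<lambda>\<gamma>. of_real (Im (\<Phi> \<gamma> h))) = (\<lambda>\<gamma>. (-\<i>/2) * pairing \<gamma> h + \<i>/2 * pairing \<gamma> (- h))"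
        using h by (auto simp: \<Phi>_def pairing_minus_right complex_eq_iff)
      then show ?thesis using comb f by metis
    qed
    ultimately show ?thesis by (simp add: R_def)
  qed
  interpret function_ring_on R S
  proof
    have "compactin (product_topology (\<lambda>_. euclidean) UNIV) S"
      by (auto simp: S_def compactin_PiE)
    then show "compact S"
      by (simp add: euclidean_product_topology)
  next
    fix x y assume xy: "x \<in> S" "y \<in> S" "x \<noteq> y"
    then obtain h where h: "x h \<noteq> y h" by auto
    have "x h = 1" "y h = 1" if "h \<notin> H"
      using xy that by (auto simp: S_def PiE_iff split: if_splits)
    with h have "h \<in> H" by metis
    moreover obtain f where "f = Re \<or> f = Im" "f (x h) \<noteq> f (y h)"
      using h complex_eqI[of "x h" "y h"] by blast
    ultimately show "\<exists>f\<in>R. f x \<noteq> f y"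
      by (intro bexI[OF _ coord[of h f]])
  next
    show "(\<lambda>_. c) \<in> R" for c
      using trig_polys_character[OF H0, of "of_real c"] by (simp add: R_def)
  qed (auto simp: R_def intro!: continuous_intros trig_polys_add trig_polys_mult Hadd)
  have "\<Phi> ` L \<inter> \<Phi> ` K = {}"
  proof -
    have "\<Phi> \<gamma> \<noteq> \<Phi> \<delta>" if "\<gamma> \<in> K" "\<delta> \<in> L" for \<gamma> \<delta>
    proof
      assume "\<Phi> \<gamma> = \<Phi> \<delta>"
      then have "pairing \<gamma> h = pairing \<delta> h" if "h \<in> H" for h
        using fun_cong[OF \<open>\<Phi> \<gamma> = \<Phi> \<delta>\<close>, of h] that unfolding \<Phi>_def by simp
      then have "\<gamma> - \<delta> \<in> annihilator H"
        by (auto simp: annihilator_def pairing_diff complex_norm_square[symmetric])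
      then show False using sep that by blast
    qed
    then show ?thesis by fastforce
  qed
  then obtain f where f: "f \<in> R" "f ` S \<subseteq> {0..1}" "\<And>\<gamma>. \<gamma> \<in> L \<Longrightarrow> f (\<Phi> \<gamma>) < e"
      "\<And>\<gamma>. \<gamma> \<in> K \<Longrightarrow> f (\<Phi> \<gamma>) > 1 - e"
    using two[of "\<Phi> ` L" "\<Phi> ` K" e] e \<Phi>S
    by (force intro!: compact_imp_closed compact_continuous_image \<Phi>cont K L)
  show thesis
    by (rule that[of "\<lambda>\<gamma>. f (\<Phi> \<gamma>)"]) (use f \<Phi>S in \<open>auto simp: R_def image_subset_iff\<close>)
qed

section \<open>Approximation in \<open>L\<^sup>\<alpha>\<close>\<close>

text \<open>Membership in the closure for functions in place of classes, and with the same formula for all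
  exponents: the \<open>\<alpha>\<close>-th root in the metric for \<open>\<alpha> \<ge> 1\<close> does not change which distances are small.\<close>

definition approximable :: "real \<Rightarrow> 'b measure \<Rightarrow> ('b \<Rightarrow> complex) set \<Rightarrow> ('b \<Rightarrow> complex) \<Rightarrow> bool" where
  "approximable \<alpha> M A f \<longleftrightarrow>
     f \<in> Lp_functions \<alpha> M \<and> (\<forall>\<epsilon>>0. \<exists>p\<in>A. (\<integral>x. norm (f x - p x) powr \<alpha> \<partial>M) < \<epsilon>)"

lemma integrable_Lp_functions:
  "f \<in> Lp_functions \<alpha> M \<Longrightarrow> integrable M (\<lambda>x. norm (f x) powr \<alpha>)"
  by (simp add: Lp_functions_def)

lemma Lp_functions_scale:
  assumes "f \<in> Lp_functions \<alpha> M"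
  shows "(\<lambda>x. c * f x) \<in> Lp_functions \<alpha> M"
  using assms by (auto simp: Lp_functions_def norm_mult powr_mult)

lemma Lp_functions_indicator:
  assumes B: "B \<in> sets M" and f: "f \<in> Lp_functions \<alpha> M"
  shows "(\<lambda>x. indicator B x * f x) \<in> Lp_functions \<alpha> M"
proof -
  note [measurable] = B Lp_functions_measurable[OF f]
  have "norm (norm (indicator B x * f x) powr \<alpha>) \<le> norm (norm (f x) powr \<alpha>)" for x
    by (auto simp: indicator_def)
  then have "integrable M (\<lambda>x. norm (indicator B x * f x) powr \<alpha>)"
    by (intro Bochner_Integration.integrable_bound[OF integrable_Lp_functions[OF f]] AE_I2) measurable
  then show ?thesis by (simp add: Lp_functions_def)
qed

text \<open>A quasi-triangle inequality that treats \<open>\<alpha> < 1\<close> and \<open>\<alpha> \<ge> 1\<close> alike.\<close>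

lemma norm_add_powr_le:
  fixes u v :: complex
  assumes "\<alpha> > 0"
  shows "norm (u + v) powr \<alpha> \<le> 2 powr \<alpha> * (norm u powr \<alpha> + norm v powr \<alpha>)"
proof -
  let ?m = "max (norm u) (norm v)"
  have "norm (u + v) \<le> 2 * ?m"
    using norm_triangle_ineq[of u v] by linarith
  then have "norm (u + v) powr \<alpha> \<le> (2 * ?m) powr \<alpha>"
    using assms by (intro powr_mono2) auto
  also have "\<dots> = 2 powr \<alpha> * ?m powr \<alpha>" by (simp add: powr_mult)
  also have "\<dots> \<le> 2 powr \<alpha> * (norm u powr \<alpha> + norm v powr \<alpha>)"
    by (intro mult_left_mono) (auto simp: max_def)
  finally show ?thesis .
qed

lemma integral_norm_add_powr_le:
  assumes "f \<in> Lp_functions \<alpha> M" "g \<in> Lp_functions \<alpha> M" "\<alpha> > 0"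
  shows "(\<integral>x. norm (f x + g x) powr \<alpha> \<partial>M) \<le>
    2 powr \<alpha> * ((\<integral>x. norm (f x) powr \<alpha> \<partial>M) + (\<integral>x. norm (g x) powr \<alpha> \<partial>M))"
proof -
  have "(\<integral>x. norm (f x + g x) powr \<alpha> \<partial>M) \<le>
      (\<integral>x. 2 powr \<alpha> * (norm (f x) powr \<alpha> + norm (g x) powr \<alpha>) \<partial>M)"
    using Lp_functions_add[OF assms] assms
    by (intro integral_mono norm_add_powr_le) (auto simp: integrable_Lp_functions)
  then show ?thesis using assms by (simp add: integrable_Lp_functions)
qed

lemma fun_dist_small_iff:
  assumes "\<alpha> > 0"
  shows "(\<forall>r>0. \<exists>p\<in>A. fun_dist \<alpha> M f p < r) \<longleftrightarrow>
    (\<forall>\<epsilon>>0. \<exists>p\<in>A. (\<integral>x. norm (f x - p x) powr \<alpha> \<partial>M) < \<epsilon>)"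
proof (cases "\<alpha> \<ge> 1")
  case True
  define I where "I p = (\<integral>x. norm (f x - p x) powr \<alpha> \<partial>M)" for p
  have I0: "I p \<ge> 0" for p by (simp add: I_def)
  have 1: "I p powr (1 / \<alpha>) < r \<longleftrightarrow> I p < r powr \<alpha>" if "r > 0" for p r
  proof
    assume "I p powr (1 / \<alpha>) < r"
    then have "(I p powr (1 / \<alpha>)) powr \<alpha> < r powr \<alpha>"
      using assms by (intro powr_less_mono2) auto
    then show "I p < r powr \<alpha>" using assms I0 by (simp add: powr_powr)
  next
    assume "I p < r powr \<alpha>"
    then have "I p powr (1 / \<alpha>) < (r powr \<alpha>) powr (1 / \<alpha>)"
      using assms I0 by (intro powr_less_mono2) auto
    then show "I p powr (1 / \<alpha>) < r" using assms that by (simp add: powr_powr)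
  qed
  have 2: "fun_dist \<alpha> M f p = I p powr (1 / \<alpha>)" for p
    using True by (simp add: fun_dist_def I_def)
  show ?thesis
    unfolding 2 I_def[symmetric]
  proof (intro iffI allI impI)
    fix \<epsilon> :: real assume "\<forall>r>0. \<exists>p\<in>A. I p powr (1 / \<alpha>) < r" "\<epsilon> > 0"
    moreover from \<open>\<epsilon> > 0\<close> have "\<epsilon> powr (1 / \<alpha>) > 0" by simp
    ultimately obtain p where "p \<in> A" "I p powr (1 / \<alpha>) < \<epsilon> powr (1 / \<alpha>)" by blast
    then show "\<exists>p\<in>A. I p < \<epsilon>"
      using 1[of "\<epsilon> powr (1 / \<alpha>)" p] \<open>\<epsilon> > 0\<close> assms by (auto simp: powr_powr)
  next
    fix r :: real assume "\<forall>\<epsilon>>0. \<exists>p\<in>A. I p < \<epsilon>" "r > 0"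
    moreover from \<open>r > 0\<close> have "r powr \<alpha> > 0" by simp
    ultimately obtain p where "p \<in> A" "I p < r powr \<alpha>" by blast
    then show "\<exists>p\<in>A. I p powr (1 / \<alpha>) < r"
      using 1[OF \<open>r > 0\<close>] by auto
  qed
qed (simp add: fun_dist_def)

lemma Lp_closure_eq:
  assumes \<alpha>: "\<alpha> > 0" and A: "A \<subseteq> Lp_functions \<alpha> M"
  shows "Lp_closure \<alpha> M A = {ae_rel M `` {f} | f. approximable \<alpha> M A f}"
proof -
  have cls: "ae_rel M `` {f} \<in> Lp \<alpha> M" if "f \<in> Lp_functions \<alpha> M" for f
    using that by (auto simp: Lp_def intro: quotientI)
  have iff: "ae_rel M `` {f} \<in> Lp_closure \<alpha> M A \<longleftrightarrow> approximable \<alpha> M A f"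
    if f: "f \<in> Lp_functions \<alpha> M" for f
  proof -
    have dist: "Lp_dist \<alpha> M (ae_rel M `` {f}) (ae_rel M `` {p}) = fun_dist \<alpha> M f p" if "p \<in> A" for p
      using f A that by (intro Lp_dist_class Lp_functions_measurable) auto
    have "ae_rel M `` {f} \<in> Lp_closure \<alpha> M A \<longleftrightarrow> (\<forall>r>0. \<exists>p\<in>A. fun_dist \<alpha> M f p < r)"
      unfolding Lp_closure_def Metric_space.metric_closure_of[OF Metric_space_Lp[OF \<alpha>]]
      using f A cls dist
      by (simp add: Metric_space.in_mball[OF Metric_space_Lp[OF \<alpha>]] subset_eq cong: bex_cong)
    then show ?thesis
      using f unfolding approximable_def fun_dist_small_iff[OF \<alpha>] by simp
  qed
  have sub: "Lp_closure \<alpha> M A \<subseteq> Lp \<alpha> M"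
    unfolding Lp_closure_def Metric_space.metric_closure_of[OF Metric_space_Lp[OF \<alpha>]] by auto
  show ?thesis
  proof (intro set_eqI iffI)
    fix F assume F: "F \<in> Lp_closure \<alpha> M A"
    with sub have "F \<in> Lp \<alpha> M" by blast
    then obtain f where "f \<in> Lp_functions \<alpha> M" "F = ae_rel M `` {f}"
      by (auto simp: Lp_def elim!: quotientE)
    then show "F \<in> {ae_rel M `` {f} | f. approximable \<alpha> M A f}"
      using F iff by blast
  qed (use iff in \<open>auto simp: approximable_def\<close>)
qed

lemma approximable_AE_cong:
  assumes "approximable \<alpha> M A f" "(f, g) \<in> ae_rel M" and A: "A \<subseteq> Lp_functions \<alpha> M"
  shows "approximable \<alpha> M A g"
proof -
  have f: "f \<in> borel_measurable M" "integrable M (\<lambda>x. norm (f x) powr \<alpha>)"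
    and g: "g \<in> borel_measurable M" and ae: "AE x in M. f x = g x"
    using assms by (auto simp: approximable_def Lp_functions_def ae_rel_def)
  have "integrable M (\<lambda>x. norm (g x) powr \<alpha>)"
    using f ae g by (subst integrable_cong_AE[of _ _ "\<lambda>x. norm (f x) powr \<alpha>"]) auto
  moreover have "(\<integral>x. norm (g x - p x) powr \<alpha> \<partial>M) = (\<integral>x. norm (f x - p x) powr \<alpha> \<partial>M)"
    if "p \<in> A" for p
    using f g ae A[THEN subsetD, OF that, THEN Lp_functions_measurable] by (intro integral_cong_AE) auto
  ultimately show ?thesis
    using assms g unfolding approximable_def Lp_functions_def by auto
qed

lemma approximable_trans:
  assumes f: "f \<in> Lp_functions \<alpha> M" and \<alpha>: "\<alpha> > 0" and A: "A \<subseteq> Lp_functions \<alpha> M"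
    and g: "\<And>\<epsilon>. \<epsilon> > 0 \<Longrightarrow> \<exists>g. approximable \<alpha> M A g \<and> (\<integral>x. norm (f x - g x) powr \<alpha> \<partial>M) < \<epsilon>"
  shows "approximable \<alpha> M A f"
  unfolding approximable_def
proof (intro conjI f allI impI)
  fix \<epsilon> :: real assume "\<epsilon> > 0"
  define \<delta> where "\<delta> = \<epsilon> / (2 * 2 powr \<alpha>)"
  have "\<delta> > 0" using \<open>\<epsilon> > 0\<close> by (simp add: \<delta>_def)
  then obtain g p where gp: "approximable \<alpha> M A g" "(\<integral>x. norm (f x - g x) powr \<alpha> \<partial>M) < \<delta>"
      "p \<in> A" "(\<integral>x. norm (g x - p x) powr \<alpha> \<partial>M) < \<delta>"
    using g unfolding approximable_def by meson
  then have Lp: "g \<in> Lp_functions \<alpha> M" "p \<in> Lp_functions \<alpha> M"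
    using A by (auto simp: approximable_def)
  have "(\<integral>x. norm (f x - p x) powr \<alpha> \<partial>M) = (\<integral>x. norm ((f x - g x) + (g x - p x)) powr \<alpha> \<partial>M)"
    by simp
  also have "\<dots> \<le> 2 powr \<alpha> *
      ((\<integral>x. norm (f x - g x) powr \<alpha> \<partial>M) + (\<integral>x. norm (g x - p x) powr \<alpha> \<partial>M))"
    by (intro integral_norm_add_powr_le Lp_functions_diff f Lp \<alpha>)
  also have "\<dots> < 2 powr \<alpha> * (\<delta> + \<delta>)"
    using gp by (intro mult_strict_left_mono add_strict_mono) auto
  also have "\<dots> = \<epsilon>" by (simp add: \<delta>_def)
  finally show "\<exists>p\<in>A. (\<integral>x. norm (f x - p x) powr \<alpha> \<partial>M) < \<epsilon>"
    using gp(3) by blast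
qed

lemma approximable_add:
  assumes f: "approximable \<alpha> M A f" and g: "approximable \<alpha> M A g"
    and \<alpha>: "\<alpha> > 0" and A: "A \<subseteq> Lp_functions \<alpha> M"
    and add: "\<And>p q. p \<in> A \<Longrightarrow> q \<in> A \<Longrightarrow> (\<lambda>x. p x + q x) \<in> A"
  shows "approximable \<alpha> M A (\<lambda>x. f x + g x)"
  unfolding approximable_def
proof (intro conjI allI impI)
  have Lp: "f \<in> Lp_functions \<alpha> M" "g \<in> Lp_functions \<alpha> M"
    using f g by (auto simp: approximable_def)
  then show "(\<lambda>x. f x + g x) \<in> Lp_functions \<alpha> M"
    using \<alpha> by (intro Lp_functions_add)
  fix \<epsilon> :: real assume "\<epsilon> > 0"
  define \<delta> where "\<delta> = \<epsilon> / (2 * 2 powr \<alpha>)"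
  have "\<delta> > 0" using \<open>\<epsilon> > 0\<close> by (simp add: \<delta>_def)
  then obtain p q where pq: "p \<in> A" "(\<integral>x. norm (f x - p x) powr \<alpha> \<partial>M) < \<delta>"
      "q \<in> A" "(\<integral>x. norm (g x - q x) powr \<alpha> \<partial>M) < \<delta>"
    using f g unfolding approximable_def by meson
  have "(\<integral>x. norm ((f x + g x) - (p x + q x)) powr \<alpha> \<partial>M) =
      (\<integral>x. norm ((f x - p x) + (g x - q x)) powr \<alpha> \<partial>M)"
    by (simp add: algebra_simps)
  also have "\<dots> \<le> 2 powr \<alpha> *
      ((\<integral>x. norm (f x - p x) powr \<alpha> \<partial>M) + (\<integral>x. norm (g x - q x) powr \<alpha> \<partial>M))"
    using pq A by (intro integral_norm_add_powr_le Lp_functions_diff Lp \<alpha>) auto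
  also have "\<dots> < 2 powr \<alpha> * (\<delta> + \<delta>)"
    using pq by (intro mult_strict_left_mono add_strict_mono) auto
  also have "\<dots> = \<epsilon>" by (simp add: \<delta>_def)
  finally show "\<exists>r\<in>A. (\<integral>x. norm ((f x + g x) - r x) powr \<alpha> \<partial>M) < \<epsilon>"
    using pq add by (intro bexI[of _ "\<lambda>x. p x + q x"]) auto
qed

lemma approximable_member:
  assumes "p \<in> A" "A \<subseteq> Lp_functions \<alpha> M" "\<alpha> > 0"
  shows "approximable \<alpha> M A p"
  using assms by (auto simp: approximable_def intro!: bexI[of _ p])

lemma approximable_scale:
  assumes f: "approximable \<alpha> M A f" and \<alpha>: "\<alpha> > 0" and A: "A \<subseteq> Lp_functions \<alpha> M"
    and scale: "\<And>p c. p \<in> A \<Longrightarrow> (\<lambda>x. c * p x) \<in> A"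
  shows "approximable \<alpha> M A (\<lambda>x. c * f x)"
proof (cases "c = 0")
  case True
  obtain p where "p \<in> A"
    using f unfolding approximable_def by (meson zero_less_one)
  then have "(\<lambda>x. 0 * p x) \<in> A" by (rule scale)
  then show ?thesis
    using approximable_member[OF _ A \<alpha>] True by simp
next
  case False
  show ?thesis
    unfolding approximable_def
  proof (intro conjI allI impI)
    show "(\<lambda>x. c * f x) \<in> Lp_functions \<alpha> M"
      using f by (auto simp: approximable_def intro: Lp_functions_scale)
    fix \<epsilon> :: real assume "\<epsilon> > 0"
    then have "\<epsilon> / norm c powr \<alpha> > 0" using False by simp
    then obtain p where p: "p \<in> A" "(\<integral>x. norm (f x - p x) powr \<alpha> \<partial>M) < \<epsilon> / norm c powr \<alpha>"
      using f unfolding approximable_def by meson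
    have "(\<integral>x. norm (c * f x - c * p x) powr \<alpha> \<partial>M) =
        norm c powr \<alpha> * (\<integral>x. norm (f x - p x) powr \<alpha> \<partial>M)"
      by (simp add: norm_mult powr_mult flip: right_diff_distrib)
    also have "\<dots> < \<epsilon>" using p(2) False by (simp add: field_simps)
    finally show "\<exists>p\<in>A. (\<integral>x. norm (c * f x - p x) powr \<alpha> \<partial>M) < \<epsilon>"
      by (intro bexI[OF _ scale[OF p(1)]])
  qed
qed

lemma approximable_sum:
  assumes "finite Y" and \<alpha>: "\<alpha> > 0" and A: "A \<subseteq> Lp_functions \<alpha> M" and "(\<lambda>_. 0) \<in> A"
    and add: "\<And>p q. p \<in> A \<Longrightarrow> q \<in> A \<Longrightarrow> (\<lambda>x. p x + q x) \<in> A"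
    and "\<And>y. y \<in> Y \<Longrightarrow> approximable \<alpha> M A (f y)"
  shows "approximable \<alpha> M A (\<lambda>x. \<Sum>y\<in>Y. f y x)"
  using assms(1,6)
proof (induction Y rule: finite_induct)
  case empty
  then show ?case using approximable_member[OF assms(4) A \<alpha>] by simp
next
  case (insert y Y)
  have "approximable \<alpha> M A (\<lambda>x. f y x + (\<Sum>y\<in>Y. f y x))"
    by (intro approximable_add[OF _ _ \<alpha> A add] insert) auto
  then show ?case using insert.hyps by simp
qed

text \<open>It suffices to approximate indicators of measurable subsets of \<open>B\<close>: \<open>f\<close> is a limit of simple
  functions bounded by \<open>2 |f|\<close>, which therefore vanish off \<open>B\<close> as well, and dominated convergence with
  the majorant \<open>3\<^sup>\<alpha> |f|\<^sup>\<alpha>\<close> gives convergence in \<open>L\<^sup>\<alpha>\<close>.\<close>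

lemma approximable_supported:
  assumes f: "f \<in> Lp_functions \<alpha> M" and supp: "\<And>x. x \<notin> B \<Longrightarrow> f x = 0"
    and \<alpha>: "\<alpha> > 0" and A: "A \<subseteq> Lp_functions \<alpha> M" and zero: "(\<lambda>_. 0) \<in> A"
    and add: "\<And>p q. p \<in> A \<Longrightarrow> q \<in> A \<Longrightarrow> (\<lambda>x. p x + q x) \<in> A"
    and scale: "\<And>p c. p \<in> A \<Longrightarrow> (\<lambda>x. c * p x) \<in> A"
    and ind: "\<And>S. S \<in> sets M \<Longrightarrow> S \<subseteq> B \<Longrightarrow> approximable \<alpha> M A (indicator S)"
  shows "approximable \<alpha> M A f"
proof -
  have [measurable]: "f \<in> borel_measurable M"
    using f by (rule Lp_functions_measurable)
  obtain s where simple: "\<And>i. simple_function M (s i)"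
    and lim: "\<And>x. x \<in> space M \<Longrightarrow> (\<lambda>i. s i x) \<longlonglongrightarrow> f x"
    and bound: "\<And>i x. x \<in> space M \<Longrightarrow> norm (s i x) \<le> 2 * norm (f x)"
    using borel_measurable_implies_sequence_metric[OF \<open>f \<in> borel_measurable M\<close>, of 0]
    by (simp add: dist_norm) metis
  have [measurable]: "s i \<in> borel_measurable M" for i
    using simple by (rule borel_measurable_simple_function)
  have approx: "approximable \<alpha> M A (s i)" for i
  proof -
    have "approximable \<alpha> M A (\<lambda>x. y * indicator (s i -` {y} \<inter> space M) x)" for y
    proof (cases "y = 0")
      case True
      then show ?thesis using approximable_member[OF zero A \<alpha>] by simp
    next
      case False
      have "x \<in> B" if x: "x \<in> s i -` {y} \<inter> space M" for x
      proof (rule ccontr)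
        assume "x \<notin> B"
        then have "s i x = 0" using bound[of x i] x supp[of x] by simp
        then show False using x False by simp
      qed
      moreover have "s i -` {y} \<inter> space M \<in> sets M" by measurable
      ultimately show ?thesis
        by (intro approximable_scale[OF ind \<alpha> A scale]) auto
    qed
    then have sum: "approximable \<alpha> M A (\<lambda>x. \<Sum>y\<in>s i ` space M. y * indicator (s i -` {y} \<inter> space M) x)"
      by (intro approximable_sum simple_functionD(1)[OF simple] \<alpha> A zero add)
    have "(\<Sum>y\<in>s i ` space M. y * indicator (s i -` {y} \<inter> space M) x) = s i x"
      if "x \<in> space M" for x
      by (subst simple_function_indicator_representation_banach[OF simple that])
         (auto intro!: sum.cong simp: indicator_def)
    then have "AE x in M. (\<Sum>y\<in>s i ` space M. y * indicator (s i -` {y} \<inter> space M) x) = s i x"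
      by (rule AE_I2)
    with sum show ?thesis
      by (intro approximable_AE_cong[OF sum _ A]) (simp add: ae_rel_def approximable_def Lp_functions_def)
  qed
  have "(\<lambda>i. \<integral>x. norm (f x - s i x) powr \<alpha> \<partial>M) \<longlonglongrightarrow> (\<integral>x. 0 \<partial>M)"
  proof (rule integral_dominated_convergence)
    show "integrable M (\<lambda>x. 3 powr \<alpha> * norm (f x) powr \<alpha>)"
      using f by (simp add: integrable_Lp_functions)
    show "AE x in M. (\<lambda>i. norm (f x - s i x) powr \<alpha>) \<longlonglongrightarrow> 0"
    proof (rule AE_I2)
      fix x assume "x \<in> space M"
      then have "(\<lambda>i. norm (f x - s i x)) \<longlonglongrightarrow> norm (f x - f x)"
        by (intro tendsto_intros lim)
      then have "(\<lambda>i. norm (f x - s i x) powr \<alpha>) \<longlonglongrightarrow> 0 powr \<alpha>"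
        using \<alpha> by (intro tendsto_powr') auto
      then show "(\<lambda>i. norm (f x - s i x) powr \<alpha>) \<longlonglongrightarrow> 0" by simp
    qed
    show "AE x in M. norm (norm (f x - s i x) powr \<alpha>) \<le> 3 powr \<alpha> * norm (f x) powr \<alpha>" for i
    proof (rule AE_I2)
      fix x assume "x \<in> space M"
      then have "norm (f x - s i x) \<le> 3 * norm (f x)"
        using norm_triangle_ineq4[of "f x" "s i x"] bound[of x i] by simp
      then have "norm (f x - s i x) powr \<alpha> \<le> (3 * norm (f x)) powr \<alpha>"
        using \<alpha> by (intro powr_mono2) auto
      then show "norm (norm (f x - s i x) powr \<alpha>) \<le> 3 powr \<alpha> * norm (f x) powr \<alpha>"
        by (simp add: powr_mult)
    qed
  qed simp_all
  then have lim0: "(\<lambda>i. \<integral>x. norm (f x - s i x) powr \<alpha> \<partial>M) \<longlonglongrightarrow> 0" by simp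
  show ?thesis
  proof (rule approximable_trans[OF f \<alpha> A])
    fix \<epsilon> :: real assume "\<epsilon> > 0"
    then have "eventually (\<lambda>i. (\<integral>x. norm (f x - s i x) powr \<alpha> \<partial>M) < \<epsilon>) sequentially"
      by (rule order_tendstoD(2)[OF lim0])
    then obtain i where "(\<integral>x. norm (f x - s i x) powr \<alpha> \<partial>M) < \<epsilon>"
      by (auto simp: eventually_sequentially)
    then show "\<exists>g. approximable \<alpha> M A g \<and> (\<integral>x. norm (f x - g x) powr \<alpha> \<partial>M) < \<epsilon>"
      using approx by blast
  qed
qed

section \<open>Finite measures on the dual group\<close>

lemma regular_borel_measure_sets: "regular_borel_measure M \<Longrightarrow> sets M = sets borel"
  unfolding regular_borel_measure_def by (elim conjE) assumption

lemma regular_borel_measure_finite: "regular_borel_measure M \<Longrightarrow> finite_measure M"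
  unfolding regular_borel_measure_def by (elim conjE) assumption

lemma regular_borel_measure_space: "regular_borel_measure M \<Longrightarrow> space M = UNIV"
  by (rule trans[OF sets_eq_imp_space_eq space_borel], rule regular_borel_measure_sets)

lemma bounded_Lp_functions:
  assumes "finite_measure M" "f \<in> borel_measurable M" "\<And>x. norm (f x) \<le> C" "\<alpha> > 0"
  shows "f \<in> Lp_functions \<alpha> M"
proof -
  interpret finite_measure M by fact
  have "norm (norm (f x) powr \<alpha>) \<le> C powr \<alpha>" for x
    using assms(3)[of x] assms(4) by (auto intro: powr_mono2)
  then have "integrable M (\<lambda>x. norm (f x) powr \<alpha>)"
    using assms(2) by (intro integrable_const_bound[of _ "C powr \<alpha>"]) auto
  then show ?thesis using assms(2) by (simp add: Lp_functions_def)
qed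

lemma trig_polys_Lp_functions:
  assumes M: "regular_borel_measure M" and "\<alpha> > 0"
  shows "trig_polys S \<subseteq> Lp_functions \<alpha> M"
proof
  fix p assume p: "p \<in> trig_polys S"
  have "p \<in> borel_measurable M"
    using borel_measurable_continuous_onI[OF continuous_on_trig_polys[OF p]]
    by (simp add: measurable_cong_sets[OF regular_borel_measure_sets[OF M] refl])
  then show "p \<in> Lp_functions \<alpha> M"
    using bounded_trig_polys[OF p] bounded_Lp_functions[OF regular_borel_measure_finite[OF M] _ _ assms(2)]
    by metis
qed

section \<open>Restricting a measure to a Borel set\<close>

lemma Lp_functions_restrict_iff:
  assumes B: "B \<in> sets M" and f: "f \<in> borel_measurable M"
  shows "f \<in> Lp_functions \<alpha> (density M (indicator B)) \<longleftrightarrow>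
    (\<lambda>x. indicator B x * f x) \<in> Lp_functions \<alpha> M"
proof -
  have "norm (indicator B x * f x) powr \<alpha> = indicator B x *\<^sub>R norm (f x) powr \<alpha>" for x
    by (auto simp: indicator_def)
  moreover have "density M (indicator B) = density M (\<lambda>x. ennreal (indicator B x))"
    by (simp add: ennreal_indicator)
  ultimately show ?thesis
    using B f by (simp add: Lp_functions_def integrable_density del: ennreal_indicator)
qed

lemma ae_rel_restrict_iff:
  assumes B: "B \<in> sets M" and f: "f \<in> borel_measurable M" "g \<in> borel_measurable M"
  shows "(f, g) \<in> ae_rel (density M (indicator B)) \<longleftrightarrow>
    (\<lambda>x. indicator B x * f x, \<lambda>x. indicator B x * g x) \<in> ae_rel M"
proof -
  have "(AE x in density M (indicator B). f x = g x) \<longleftrightarrow> (AE x in M. x \<in> B \<longrightarrow> f x = g x)"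
    using B by (subst AE_density) (auto simp: indicator_def)
  also have "\<dots> \<longleftrightarrow> (AE x in M. indicator B x * f x = indicator B x * g x)"
    by (rule AE_cong) (auto simp: indicator_def)
  finally show ?thesis using B f by (simp add: ae_rel_def)
qed

lemma Lp_indicator_class:
  assumes B: "B \<in> sets M" and f: "f \<in> borel_measurable M"
  shows "Lp_indicator M B (ae_rel (density M (indicator B)) `` {f}) = ae_rel M `` {\<lambda>x. indicator B x * f x}"
    and "Lp_indicator M B (ae_rel M `` {f}) = ae_rel M `` {\<lambda>x. indicator B x * f x}"
proof -
  have cls: "ae_rel M `` {\<lambda>x. indicator B x * g x} = ae_rel M `` {\<lambda>x. indicator B x * f x}"
    if "(f, g) \<in> ae_rel (density M (indicator B))" for g
  proof -
    have "g \<in> borel_measurable M" using that by (simp add: ae_rel_def)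
    then show ?thesis
      using that ae_rel_restrict_iff[OF B f] equiv_class_eq[OF equiv_ae_rel] by metis
  qed
  have self: "(f, f) \<in> ae_rel M" "(f, f) \<in> ae_rel (density M (indicator B))"
    using f by (auto simp: ae_rel_def)
  show "Lp_indicator M B (ae_rel (density M (indicator B)) `` {f}) = ae_rel M `` {\<lambda>x. indicator B x * f x}"
    unfolding Lp_indicator_def using cls self(2) by blast
  have "(f, g) \<in> ae_rel (density M (indicator B))" if g: "(f, g) \<in> ae_rel M" for g
  proof -
    have "g \<in> borel_measurable M" "AE x in M. f x = g x" using g by (auto simp: ae_rel_def)
    then have "AE x in M. indicator B x * f x = indicator B x * g x"
      by (auto elim: eventually_mono)
    then show ?thesis
      using B f \<open>g \<in> borel_measurable M\<close> by (subst ae_rel_restrict_iff) (auto simp: ae_rel_def)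
  qed
  then show "Lp_indicator M B (ae_rel M `` {f}) = ae_rel M `` {\<lambda>x. indicator B x * f x}"
    unfolding Lp_indicator_def using cls self(1) by blast
qed

lemma Lp_add_class:
  assumes f: "f \<in> borel_measurable M" and g: "g \<in> borel_measurable M"
  shows "Lp_add M (ae_rel M `` {f}) (ae_rel M `` {g}) = ae_rel M `` {\<lambda>x. f x + g x}"
proof -
  have "ae_rel M `` {\<lambda>x. f' x + g' x} = ae_rel M `` {\<lambda>x. f x + g x}"
    if "(f, f') \<in> ae_rel M" "(g, g') \<in> ae_rel M" for f' g'
  proof -
    have "f' \<in> borel_measurable M" "g' \<in> borel_measurable M" "AE x in M. f x = f' x" "AE x in M. g x = g' x"
      using that by (auto simp: ae_rel_def)
    moreover from this(3,4) have "AE x in M. f x + g x = f' x + g' x"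
      by eventually_elim simp
    ultimately have "(\<lambda>x. f x + g x, \<lambda>x. f' x + g' x) \<in> ae_rel M"
      using f g by (simp add: ae_rel_def)
    then show ?thesis using equiv_class_eq[OF equiv_ae_rel] by metis
  qed
  moreover have "(f, f) \<in> ae_rel M" "(g, g) \<in> ae_rel M" using f g by (auto simp: ae_rel_def)
  ultimately show ?thesis unfolding Lp_add_def by blast
qed

lemma Lp_scale_class:
  assumes f: "f \<in> borel_measurable M"
  shows "Lp_scale M c (ae_rel M `` {f}) = ae_rel M `` {\<lambda>x. c * f x}"
proof -
  have "ae_rel M `` {\<lambda>x. c * f' x} = ae_rel M `` {\<lambda>x. c * f x}" if "(f, f') \<in> ae_rel M" for f'
  proof -
    have "f' \<in> borel_measurable M" "AE x in M. f x = f' x"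
      using that by (auto simp: ae_rel_def)
    moreover from this(2) have "AE x in M. c * f x = c * f' x"
      by eventually_elim simp
    ultimately have "(\<lambda>x. c * f x, \<lambda>x. c * f' x) \<in> ae_rel M"
      using f by (simp add: ae_rel_def)
    then show ?thesis using equiv_class_eq[OF equiv_ae_rel] by metis
  qed
  moreover have "(f, f) \<in> ae_rel M" using f by (auto simp: ae_rel_def)
  ultimately show ?thesis unfolding Lp_scale_def by blast
qed

lemma Lp_eq_classes: "Lp \<alpha> M = {ae_rel M `` {f} | f. f \<in> Lp_functions \<alpha> M}"
  by (auto simp: Lp_def quotient_def)

text \<open>Both \<open>1\<^sub>B L\<^sup>\<alpha>(M)\<close> and the embedded copy of \<open>L\<^sup>\<alpha>\<close> of the restricted measure consist of the classes
  with a representative that vanishes everywhere off \<open>B\<close>. This common description links the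
  identifications to \<open>Inter_Lp_closure_trig_polys\<close>.\<close>

lemma Lp_indicator_image:
  assumes B: "B \<in> sets M"
  shows "Lp_indicator M B ` Lp \<alpha> (density M (indicator B)) =
      {ae_rel M `` {f} | f. f \<in> Lp_functions \<alpha> M \<and> (\<forall>x. x \<notin> B \<longrightarrow> f x = 0)}" (is "?L = ?R")
    and "Lp_indicator M B ` Lp \<alpha> M =
      {ae_rel M `` {f} | f. f \<in> Lp_functions \<alpha> M \<and> (\<forall>x. x \<notin> B \<longrightarrow> f x = 0)}" (is "?L' = ?R")
proof -
  have supp: "(\<lambda>x. indicator B x * f x) = f" if "\<forall>x. x \<notin> B \<longrightarrow> f x = 0" for f :: "'a \<Rightarrow> complex"
    using that by (auto simp: indicator_def fun_eq_iff)
  show "?L = ?R"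
  proof
    show "?L \<subseteq> ?R"
    proof
      fix F assume "F \<in> ?L"
      then obtain f where f: "f \<in> Lp_functions \<alpha> (density M (indicator B))"
          "F = Lp_indicator M B (ae_rel (density M (indicator B)) `` {f})"
        by (auto simp: Lp_eq_classes)
      have fm: "f \<in> borel_measurable M" using Lp_functions_measurable[OF f(1)] by simp
      have "F = ae_rel M `` {\<lambda>x. indicator B x * f x}"
        unfolding f(2) by (rule Lp_indicator_class(1)[OF B fm])
      moreover have "(\<lambda>x. indicator B x * f x) \<in> Lp_functions \<alpha> M"
        using f(1) Lp_functions_restrict_iff[OF B fm] by blast
      ultimately show "F \<in> ?R"
        by (intro CollectI exI[of _ "\<lambda>x. indicator B x * f x"]) auto
    qed
    show "?R \<subseteq> ?L"
    proof
      fix F assume "F \<in> ?R"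
      then obtain f where f: "F = ae_rel M `` {f}" "f \<in> Lp_functions \<alpha> M" "\<forall>x. x \<notin> B \<longrightarrow> f x = 0"
        by blast
      have fm: "f \<in> borel_measurable M" using f(2) by (rule Lp_functions_measurable)
      have "F = Lp_indicator M B (ae_rel (density M (indicator B)) `` {f})"
        unfolding Lp_indicator_class(1)[OF B fm] supp[OF f(3)] by (rule f(1))
      moreover have "f \<in> Lp_functions \<alpha> (density M (indicator B))"
        unfolding Lp_functions_restrict_iff[OF B fm] supp[OF f(3)] by (rule f(2))
      ultimately show "F \<in> ?L" by (auto simp: Lp_eq_classes)
    qed
  qed
  show "?L' = ?R"
  proof
    show "?L' \<subseteq> ?R"
    proof
      fix F assume "F \<in> ?L'"
      then obtain f where f: "f \<in> Lp_functions \<alpha> M" "F = Lp_indicator M B (ae_rel M `` {f})"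
        by (auto simp: Lp_eq_classes)
      have "F = ae_rel M `` {\<lambda>x. indicator B x * f x}"
        unfolding f(2) by (rule Lp_indicator_class(2)[OF B Lp_functions_measurable[OF f(1)]])
      then show "F \<in> ?R"
        using Lp_functions_indicator[OF B f(1)]
        by (intro CollectI exI[of _ "\<lambda>x. indicator B x * f x"]) auto
    qed
    show "?R \<subseteq> ?L'"
    proof
      fix F assume "F \<in> ?R"
      then obtain f where f: "F = ae_rel M `` {f}" "f \<in> Lp_functions \<alpha> M" "\<forall>x. x \<notin> B \<longrightarrow> f x = 0"
        by blast
      have "F = Lp_indicator M B (ae_rel M `` {f})"
        unfolding Lp_indicator_class(2)[OF B Lp_functions_measurable[OF f(2)]] supp[OF f(3)] by (rule f(1))
      then show "F \<in> ?L'" using f(2) by (auto simp: Lp_eq_classes)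
    qed
  qed
qed

lemma Lp_identified_restrict:
  assumes B: "B \<in> sets M"
  shows "Lp_identified \<alpha> (density M (indicator B)) M B"
proof -
  let ?N = "density M (indicator B)"
  have rep: "\<exists>f. f \<in> borel_measurable M \<and> F = ae_rel ?N `` {f}" if "F \<in> Lp \<alpha> ?N" for F
    using that Lp_functions_measurable[of _ \<alpha> ?N] by (auto simp: Lp_eq_classes)
  have dens: "?N = density M (\<lambda>x. ennreal (indicator B x))"
    by (simp add: ennreal_indicator)
  show ?thesis
    unfolding Lp_identified_def
  proof (intro conjI ballI allI)
    have "inj_on (Lp_indicator M B) (Lp \<alpha> ?N)"
    proof (rule inj_onI)
      fix F G assume FG: "F \<in> Lp \<alpha> ?N" "G \<in> Lp \<alpha> ?N" "Lp_indicator M B F = Lp_indicator M B G"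
      obtain f g where f: "f \<in> borel_measurable M" "F = ae_rel ?N `` {f}"
          and g: "g \<in> borel_measurable M" "G = ae_rel ?N `` {g}"
        using rep FG by metis
      have meas: "(\<lambda>x. indicator B x * f x) \<in> borel_measurable M" "(\<lambda>x. indicator B x * g x) \<in> borel_measurable M"
        using B f(1) g(1) by measurable
      have "(\<lambda>x. indicator B x * f x, \<lambda>x. indicator B x * g x) \<in> ae_rel M"
        using FG(3) f g meas by (simp add: Lp_indicator_class[OF B] eq_equiv_class_iff[OF equiv_ae_rel])
      then have "(f, g) \<in> ae_rel ?N" using ae_rel_restrict_iff[OF B f(1) g(1)] by blast
      then show "F = G" using equiv_class_eq[OF equiv_ae_rel] f(2) g(2) by metis
    qed
    then show "bij_betw (Lp_indicator M B) (Lp \<alpha> ?N) (Lp_indicator M B ` Lp \<alpha> M)"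
      by (simp add: bij_betw_def Lp_indicator_image[OF B])
  next
    fix F G assume FG: "F \<in> Lp \<alpha> ?N" "G \<in> Lp \<alpha> ?N"
    obtain f g where f[measurable]: "f \<in> borel_measurable M" and F: "F = ae_rel ?N `` {f}"
        and g[measurable]: "g \<in> borel_measurable M" and G: "G = ae_rel ?N `` {g}"
      using rep FG by metis
    note [measurable] = B
    show "Lp_indicator M B (Lp_add ?N F G) = Lp_add M (Lp_indicator M B F) (Lp_indicator M B G)"
      unfolding F G by (simp add: Lp_add_class Lp_indicator_class[OF B] distrib_left)
    have "(\<integral>x. norm (indicator B x * f x - indicator B x * g x) powr \<alpha> \<partial>M) =
        (\<integral>x. indicator B x *\<^sub>R norm (f x - g x) powr \<alpha> \<partial>M)"
      by (intro Bochner_Integration.integral_cong) (auto simp: indicator_def)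
    also have "\<dots> = (\<integral>x. norm (f x - g x) powr \<alpha> \<partial>?N)"
      unfolding dens by (subst integral_density) auto
    finally show "Lp_dist \<alpha> M (Lp_indicator M B F) (Lp_indicator M B G) = Lp_dist \<alpha> ?N F G"
      unfolding F G by (simp add: Lp_dist_class Lp_indicator_class[OF B] fun_dist_def)
  next
    fix c F assume "F \<in> Lp \<alpha> ?N"
    then obtain f where f[measurable]: "f \<in> borel_measurable M" and F: "F = ae_rel ?N `` {f}"
      using rep by metis
    note [measurable] = B
    show "Lp_indicator M B (Lp_scale ?N c F) = Lp_scale M c (Lp_indicator M B F)"
      unfolding F by (simp add: Lp_scale_class Lp_indicator_class[OF B] mult.left_commute)
  qed
qed

lemma Lp_direct_sum_restrict:
  assumes B: "B \<in> sets M" and sp: "space M = UNIV" and \<alpha>: "\<alpha> > 0"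
  shows "Lp_direct_sum M (Lp \<alpha> M)
    (Lp_indicator M (- B) ` Lp \<alpha> (density M (indicator (- B))))
    (Lp_indicator M B ` Lp \<alpha> (density M (indicator B)))"
proof -
  have C: "- B \<in> sets M"
    using sets.compl_sets[OF B] by (simp add: sp Compl_eq_Diff_UNIV)
  define U where "U A = {ae_rel M `` {f} | f. f \<in> Lp_functions \<alpha> M \<and> (\<forall>x. x \<notin> A \<longrightarrow> f x = 0)}" for A
  have "Lp \<alpha> M = {Lp_add M F G | F G. F \<in> U (- B) \<and> G \<in> U B}" (is "_ = ?R")
  proof
    show "Lp \<alpha> M \<subseteq> ?R"
    proof
      fix F assume "F \<in> Lp \<alpha> M"
      then obtain f where f: "f \<in> Lp_functions \<alpha> M" "F = ae_rel M `` {f}"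
        by (auto simp: Lp_eq_classes)
      let ?g = "\<lambda>x. indicator (- B) x * f x" and ?h = "\<lambda>x. indicator B x * f x"
      have gh: "?g \<in> Lp_functions \<alpha> M" "?h \<in> Lp_functions \<alpha> M"
        using f(1) by (auto intro: Lp_functions_indicator B C)
      have "(\<lambda>x. ?g x + ?h x) = f" by (auto simp: indicator_def)
      then have "F = Lp_add M (ae_rel M `` {?g}) (ae_rel M `` {?h})"
        using gh f(2) by (simp add: Lp_add_class Lp_functions_measurable)
      moreover have "ae_rel M `` {?g} \<in> U (- B)"
        unfolding U_def using gh(1) by (intro CollectI exI[of _ ?g]) auto
      moreover have "ae_rel M `` {?h} \<in> U B"
        unfolding U_def using gh(2) by (intro CollectI exI[of _ ?h]) auto
      ultimately show "F \<in> ?R" by blast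
    qed
    show "?R \<subseteq> Lp \<alpha> M"
    proof
      fix F assume "F \<in> ?R"
      then obtain f g where fg: "f \<in> Lp_functions \<alpha> M" "g \<in> Lp_functions \<alpha> M"
          "F = Lp_add M (ae_rel M `` {f}) (ae_rel M `` {g})"
        unfolding U_def by blast
      then have "F = ae_rel M `` {\<lambda>x. f x + g x}"
        by (simp add: Lp_add_class Lp_functions_measurable)
      then show "F \<in> Lp \<alpha> M"
        using Lp_functions_add[OF fg(1,2) \<alpha>] by (auto simp: Lp_eq_classes)
    qed
  qed
  moreover have "U (- B) \<inter> U B = {Lp_zero M}"
  proof
    have "(\<lambda>_. 0) \<in> Lp_functions \<alpha> M" by (simp add: Lp_functions_def)
    then show "{Lp_zero M} \<subseteq> U (- B) \<inter> U B"
      unfolding U_def Lp_zero_def by blast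
    show "U (- B) \<inter> U B \<subseteq> {Lp_zero M}"
    proof
      fix F assume "F \<in> U (- B) \<inter> U B"
      then obtain f g where f: "f \<in> Lp_functions \<alpha> M" "\<forall>x. x \<notin> - B \<longrightarrow> f x = 0" "F = ae_rel M `` {f}"
          and g: "g \<in> Lp_functions \<alpha> M" "\<forall>x. x \<notin> B \<longrightarrow> g x = 0" "F = ae_rel M `` {g}"
        unfolding U_def by blast
      have m: "f \<in> borel_measurable M" "g \<in> borel_measurable M"
        using f(1) g(1) by (auto simp: Lp_functions_def)
      then have "(f, g) \<in> ae_rel M"
        using f(3) g(3) by (metis eq_equiv_class_iff[OF equiv_ae_rel])
      then have "AE x in M. f x = g x" by (simp add: ae_rel_def)
      then have "AE x in M. f x = 0"
        by eventually_elim (use f(2) g(2) in force)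
      then have "(f, \<lambda>_. 0) \<in> ae_rel M" using m by (simp add: ae_rel_def)
      then show "F \<in> {Lp_zero M}"
        unfolding f(3) Lp_zero_def using equiv_class_eq[OF equiv_ae_rel] by blast
    qed
  qed
  ultimately show ?thesis
    unfolding Lp_direct_sum_def Lp_indicator_image(1)[OF B] Lp_indicator_image(1)[OF C] U_def by blast
qed

lemma regular_borel_measure_restrict:
  fixes M :: "'b::t2_space measure"
  assumes M: "regular_borel_measure M" and B: "B \<in> sets borel"
  shows "regular_borel_measure (density M (indicator B))"
  unfolding regular_borel_measure_def
proof (intro conjI ballI allI impI)
  interpret finite_measure M using M by (rule regular_borel_measure_finite)
  note sets = regular_borel_measure_sets[OF M]
  have Bm: "B \<in> sets M" unfolding sets by (rule B)
  show "sets (density M (indicator B)) = sets borel" using sets by simp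
  show "finite_measure (density M (indicator B))" by (rule finite_measure_restricted[OF Bm])
  fix A :: "'b set" and \<epsilon> :: real assume "A \<in> sets borel" "\<epsilon> > 0"
  then have "\<exists>K U. compact K \<and> open U \<and> K \<subseteq> A \<and> A \<subseteq> U \<and> measure M (U - K) < \<epsilon>"
    using M unfolding regular_borel_measure_def by blast
  then obtain K U where K: "compact K" "open U" "K \<subseteq> A" "A \<subseteq> U" "measure M (U - K) < \<epsilon>"
    by blast
  have UK: "U - K \<in> sets M"
    unfolding sets using borel_closed[OF compact_imp_closed[OF K(1)]] borel_open[OF K(2)] by (rule sets.Diff[rotated])
  have "measure (density M (indicator B)) (U - K) \<le> measure M (U - K)"
    unfolding measure_restricted[OF Bm UK] using UK by (intro finite_measure_mono) auto
  then show "\<exists>K U. compact K \<and> open U \<and> K \<subseteq> A \<and> A \<subseteq> U \<and> measure (density M (indicator B)) (U - K) < \<epsilon>"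
    using K by (meson le_less_trans)
qed

lemma null_sets_restrict_iff:
  assumes "B \<in> sets M" "N \<in> sets M"
  shows "N \<in> null_sets (density M (indicator B)) \<longleftrightarrow> B \<inter> N \<in> null_sets M"
  using assms by (auto simp: null_sets_def emeasure_restricted)

section \<open>Sets with null translates\<close>

text \<open>For \<open>\<Lambda>\<close> a group, the preimages here are the translates of \<open>B\<close> by the nonzero elements of \<open>\<Lambda>\<close>;
  preimages make measurability immediate.\<close>

definition translate_null ::
  "'a::topological_ab_group_add dual_group set \<Rightarrow> 'a dual_group measure \<Rightarrow> 'a dual_group set \<Rightarrow> bool" where
  "translate_null \<Lambda> M B \<longleftrightarrow>
     B \<in> sets borel \<and> (\<forall>\<kappa>\<in>\<Lambda> - {0}. (\<lambda>\<gamma>. \<gamma> + \<kappa>) -` B \<in> null_sets M)"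

text \<open>Exhaustion: a countable union of sets with null translates has null translates, so the supremum
  of the masses of such sets is attained, and a set attaining it absorbs all the others up to null
  sets.\<close>

lemma exists_largest_translate_null:
  assumes M: "finite_measure M" and sets: "sets M = sets borel"
  obtains B where "translate_null \<Lambda> M B" "\<forall>N. translate_null \<Lambda> M N \<longrightarrow> N - B \<in> null_sets M"
proof -
  interpret finite_measure M by fact
  define T where "T = {B. translate_null \<Lambda> M B}"
  have meas: "B \<in> sets M" if "B \<in> T" for B
    using that sets by (simp add: T_def translate_null_def)
  have Un: "(\<Union>n::nat. F n) \<in> T" if "\<And>n. F n \<in> T" for F
    using that by (auto simp: T_def translate_null_def vimage_Union vimage_UN intro!: null_sets_UN)
  have "{} \<in> T" by (auto simp: T_def translate_null_def)
  define s where "s = Sup (measure M ` T)"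
  have bdd: "bdd_above (measure M ` T)"
    using bounded_measure by (intro bdd_aboveI[of _ "measure M (space M)"]) auto
  have "\<exists>B\<in>T. s - 1 / Suc n < measure M B" for n
  proof -
    have "\<exists>y\<in>measure M ` T. s - 1 / Suc n < y"
      unfolding s_def by (rule less_cSupD) (use \<open>{} \<in> T\<close> in auto)
    then show ?thesis by auto
  qed
  then obtain F where F: "\<And>n. F n \<in> T" "\<And>n. s - 1 / Suc n < measure M (F n)" by metis
  define B where "B = (\<Union>n. F n)"
  have B: "B \<in> T" unfolding B_def by (rule Un) (rule F(1))
  have approx: "s - 1 / Suc n \<le> measure M B" for n
    using F(2)[of n] finite_measure_mono[of "F n" B] meas[OF B] by (force simp: B_def)
  have sB: "s \<le> measure M B"
  proof (rule field_le_epsilon)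
    fix e :: real assume "e > 0"
    then obtain n where "1 / Suc n < e" by (rule nat_approx_posE)
    then show "s \<le> measure M B + e" using approx[of n] by linarith
  qed
  show thesis
  proof
    show "translate_null \<Lambda> M B" using B by (simp add: T_def)
    show "\<forall>N. translate_null \<Lambda> M N \<longrightarrow> N - B \<in> null_sets M"
    proof (intro allI impI)
      fix N assume "translate_null \<Lambda> M N"
      then have N: "N \<in> T" by (simp add: T_def)
      have "B \<union> N = (\<Union>n::nat. if n = 0 then B else N)"
        by (auto split: if_splits)
      then have "B \<union> N \<in> T"
        using Un[of "\<lambda>n. if n = 0 then B else N"] B N by simp
      then have "measure M (B \<union> N) \<le> s"
        unfolding s_def by (intro cSup_upper bdd) auto
      moreover have "measure M (B \<union> N) = measure M B + measure M (N - B)"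
        using finite_measure_Union[of B "N - B"] meas[OF B] meas[OF N] by simp
      ultimately have "measure M (N - B) = 0"
        using sB measure_nonneg[of M "N - B"] by linarith
      then show "N - B \<in> null_sets M"
        using meas[OF B] meas[OF N] by (auto simp: null_sets_def emeasure_eq_measure)
    qed
  qed
qed

section \<open>Functions supported on a set with null translates\<close>

lemma inner_compact:
  fixes M :: "'b::t2_space measure"
  assumes M: "regular_borel_measure M" and B: "B \<in> sets borel" and "\<epsilon> > 0"
  obtains K where "compact K" "K \<subseteq> B" "K \<in> sets M" "measure M (B - K) < \<epsilon>"
proof -
  interpret finite_measure M using M by (rule regular_borel_measure_finite)
  have "\<exists>K U. compact K \<and> open U \<and> K \<subseteq> B \<and> B \<subseteq> U \<and> measure M (U - K) < \<epsilon>"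
    using M B \<open>\<epsilon> > 0\<close> unfolding regular_borel_measure_def by blast
  then obtain K U where K: "compact K" "open U" "K \<subseteq> B" "B \<subseteq> U" "measure M (U - K) < \<epsilon>"
    by blast
  have sets: "K \<in> sets M" "U \<in> sets M"
    unfolding regular_borel_measure_sets[OF M]
    using borel_closed[OF compact_imp_closed[OF K(1)]] borel_open[OF K(2)] by blast+
  then have "measure M (B - K) \<le> measure M (U - K)"
    using K(4) by (intro finite_measure_mono) auto
  then show thesis using that K sets by fastforce
qed

text \<open>The null set \<open>Z\<close> collects the points that are congruent to a point of \<open>B\<close> by a nonzero element
  of \<open>\<Lambda>\<close>. A compact set \<open>L\<close> that avoids \<open>A \<union> Z\<close> contains no point congruent to a point of \<open>A\<close>, hence
  is separated from any compact \<open>K \<subseteq> A\<close> modulo \<open>\<Lambda>\<close>.\<close>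

lemma approximable_indicator:
  fixes M :: "'g::{topological_ab_group_add, t2_space} dual_group measure"
  assumes H: "closed_subgroup H" and countable: "countable (annihilator H)"
    and M: "regular_borel_measure M" and B: "translate_null (annihilator H) M B"
    and A: "A \<in> sets borel" "A \<subseteq> B" and \<alpha>: "\<alpha> > 0"
  shows "approximable \<alpha> M (trig_polys H) (indicator A)"
  unfolding approximable_def
proof (intro conjI allI impI)
  interpret finite_measure M using M by (rule regular_borel_measure_finite)
  note sets[measurable_cong] = regular_borel_measure_sets[OF M]
  note space = regular_borel_measure_space[OF M]
  note [measurable] = A(1)
  show "indicator A \<in> Lp_functions \<alpha> M"
    by (rule bounded_Lp_functions[of M _ 1]) (auto simp: \<alpha> M finite_measure_axioms indicator_def)
  fix \<epsilon> :: real assume "\<epsilon> > 0"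
  define Z where "Z = (\<Union>\<kappa>\<in>annihilator H - {0}. (\<lambda>\<gamma>. \<gamma> + \<kappa>) -` B)"
  have Z: "Z \<in> null_sets M"
    unfolding Z_def using B countable by (intro null_sets_UN') (auto simp: translate_null_def)
  then have Zb: "Z \<in> sets borel" using sets by auto
  obtain K where K: "compact K" "K \<subseteq> A" "K \<in> sets M" "measure M (A - K) < \<epsilon> / 4"
    using inner_compact[OF M A(1), of "\<epsilon> / 4"] \<open>\<epsilon> > 0\<close> by auto
  have AZ: "- (A \<union> Z) \<in> sets borel" using A(1) Zb by auto
  obtain L where L: "compact L" "L \<subseteq> - (A \<union> Z)" "L \<in> sets M" "measure M (- (A \<union> Z) - L) < \<epsilon> / 4"
    using inner_compact[OF M AZ, of "\<epsilon> / 4"] \<open>\<epsilon> > 0\<close> by auto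
  define Q where "Q = - (K \<union> L)"
  have Qm[measurable]: "Q \<in> sets M" using K(3) L(3) sets unfolding Q_def by auto
  have "measure M Q \<le> measure M ((A - K) \<union> (- (A \<union> Z) - L) \<union> Z)"
    using A(1) AZ Zb K(3) L(3) sets by (intro finite_measure_mono) (auto simp: Q_def)
  also have "\<dots> \<le> measure M ((A - K) \<union> (- (A \<union> Z) - L)) + measure M Z"
    using A(1) AZ Zb K(3) L(3) sets by (intro measure_Un_le) auto
  also have "\<dots> \<le> measure M (A - K) + measure M (- (A \<union> Z) - L) + measure M Z"
    using A(1) AZ Zb K(3) L(3) sets by (intro add_mono measure_Un_le) auto
  also have "measure M Z = 0"
    using Z by (simp add: null_sets_def measure_def)
  finally have Q: "measure M Q < \<epsilon> / 2" using K(4) L(4) by simp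
  define m where "m = measure M (space M)"
  have m: "m \<ge> 0" by (simp add: m_def)
  \<comment> \<open>Chosen such that the error on \<open>K \<union> L\<close> contributes at most \<open>e\<^sup>\<alpha> m \<le> \<epsilon> / 2\<close>.\<close>
  define e where "e = min (1/2) ((\<epsilon> / (2 * (m + 1))) powr (1 / \<alpha>))"
  have e: "0 < e" "e < 1" using m \<open>\<epsilon> > 0\<close> by (auto simp: e_def min_def)
  have "e powr \<alpha> \<le> ((\<epsilon> / (2 * (m + 1))) powr (1 / \<alpha>)) powr \<alpha>"
    using \<alpha> e by (intro powr_mono2) (auto simp: e_def)
  also have "\<dots> = \<epsilon> / (2 * (m + 1))" using \<alpha> m \<open>\<epsilon> > 0\<close> by (simp add: powr_powr)
  finally have "e powr \<alpha> * m \<le> \<epsilon> / (2 * (m + 1)) * m"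
    using m by (intro mult_right_mono)
  also have "\<dots> \<le> \<epsilon> / 2" using m \<open>\<epsilon> > 0\<close> by (simp add: field_simps)
  finally have em: "e powr \<alpha> * m \<le> \<epsilon> / 2" .
  have sep: "\<gamma> - \<delta> \<notin> annihilator H" if "\<gamma> \<in> K" "\<delta> \<in> L" for \<gamma> \<delta>
  proof
    assume ann: "\<gamma> - \<delta> \<in> annihilator H"
    have "\<gamma> - \<delta> \<noteq> 0" using that K(2) L(2) by auto
    moreover have "\<delta> + (\<gamma> - \<delta>) \<in> B" using that K(2) A(2) by auto
    ultimately have "\<delta> \<in> Z" unfolding Z_def using ann by blast
    then show False using that L(2) by auto
  qed
  obtain r where r: "(\<lambda>\<gamma>. of_real (r \<gamma>)) \<in> trig_polys H" "\<And>\<gamma>. 0 \<le> r \<gamma>" "\<And>\<gamma>. r \<gamma> \<le> 1"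
      "\<And>\<gamma>. \<gamma> \<in> K \<Longrightarrow> 1 - e < r \<gamma>" "\<And>\<gamma>. \<gamma> \<in> L \<Longrightarrow> r \<gamma> < e"
    using trig_poly_separation[OF H K(1) L(1) sep e] by blast
  have bound: "norm (indicator A \<gamma> - complex_of_real (r \<gamma>)) powr \<alpha> \<le> e powr \<alpha> + indicator Q \<gamma>" for \<gamma>
  proof -
    have "indicator A \<gamma> - complex_of_real (r \<gamma>) = complex_of_real (indicator A \<gamma> - r \<gamma>)"
      by (auto simp: indicator_def)
    then have eq: "norm (indicator A \<gamma> - complex_of_real (r \<gamma>)) = \<bar>indicator A \<gamma> - r \<gamma>\<bar>"
      by (simp only: norm_of_real)
    show ?thesis
    proof (cases "\<gamma> \<in> Q")
      case True
      have "\<bar>indicator A \<gamma> - r \<gamma>\<bar> \<le> 1"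
        using r(2)[of \<gamma>] r(3)[of \<gamma>] by (auto simp: indicator_def)
      then have "\<bar>indicator A \<gamma> - r \<gamma>\<bar> powr \<alpha> \<le> 1 powr \<alpha>"
        using \<alpha> by (intro powr_mono2) auto
      then show ?thesis using True unfolding eq by (simp add: add_increasing)
    next
      case False
      then have "\<bar>indicator A \<gamma> - r \<gamma>\<bar> \<le> e"
        using r(2)[of \<gamma>] r(3)[of \<gamma>] r(4)[of \<gamma>] r(5)[of \<gamma>] K(2) L(2)
        by (auto simp: indicator_def Q_def abs_if)
      then have "\<bar>indicator A \<gamma> - r \<gamma>\<bar> powr \<alpha> \<le> e powr \<alpha>"
        using \<alpha> by (intro powr_mono2) auto
      then show ?thesis unfolding eq by (simp add: add_increasing2)
    qed
  qed
  have "(\<lambda>\<gamma>. indicator A \<gamma> - complex_of_real (r \<gamma>)) \<in> Lp_functions \<alpha> M"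
    using trig_polys_Lp_functions[OF M \<alpha>] r(1) \<open>indicator A \<in> Lp_functions \<alpha> M\<close> \<alpha>
    by (intro Lp_functions_diff) auto
  then have "(\<integral>\<gamma>. norm (indicator A \<gamma> - complex_of_real (r \<gamma>)) powr \<alpha> \<partial>M) \<le>
      (\<integral>\<gamma>. e powr \<alpha> + indicator Q \<gamma> \<partial>M)"
    by (intro integral_mono bound integrable_Lp_functions) (auto simp: emeasure_eq_measure)
  also have "\<dots> = e powr \<alpha> * m + measure M Q"
    using Qm by (simp add: m_def emeasure_eq_measure space)
  also have "\<dots> < \<epsilon>" using em Q by simp
  finally show "\<exists>p\<in>trig_polys H. (\<integral>\<gamma>. norm (indicator A \<gamma> - p \<gamma>) powr \<alpha> \<partial>M) < \<epsilon>"
    by (intro bexI[OF _ r(1)])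
qed

text \<open>Multiplication by the unimodular function \<open>\<langle>\<cdot>, x\<rangle>\<close> is an isometry of \<open>L\<^sup>\<alpha>\<close> that preserves supports
  and maps \<open>trig_polys H\<close> into \<open>trig_polys (x + H)\<close>, so only the coset \<open>H\<close> itself needs an argument.\<close>

lemma approximable_coset_of_supported:
  fixes M :: "'g::{topological_ab_group_add, t2_space} dual_group measure"
  assumes H: "closed_subgroup H" and countable: "countable (annihilator H)"
    and M: "regular_borel_measure M" and B: "translate_null (annihilator H) M B"
    and S: "S \<in> cosets H" and \<alpha>: "\<alpha> > 0"
    and f: "f \<in> Lp_functions \<alpha> M" "\<And>\<gamma>. \<gamma> \<notin> B \<Longrightarrow> f \<gamma> = 0"
  shows "approximable \<alpha> M (trig_polys S) f"
proof -
  obtain x where x: "S = (\<lambda>h. x + h) ` H" using S by (auto simp: cosets_def)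
  have [measurable]: "(\<lambda>\<gamma>. cnj (pairing \<gamma> x)) \<in> borel_measurable M"
    using borel_measurable_continuous_onI[OF continuous_on_cnj[OF continuous_on_pairing_left]]
    by (simp add: measurable_cong_sets[OF regular_borel_measure_sets[OF M] refl])
  have [measurable]: "f \<in> borel_measurable M" using f(1) by (rule Lp_functions_measurable)
  define g where "g \<gamma> = cnj (pairing \<gamma> x) * f \<gamma>" for \<gamma>
  have "g \<in> Lp_functions \<alpha> M"
  proof -
    have "g \<in> borel_measurable M" unfolding g_def by measurable
    then show ?thesis using f(1) by (simp add: Lp_functions_def g_def norm_mult)
  qed
  then have g: "approximable \<alpha> M (trig_polys H) g"
    by (rule approximable_supported[where B = B])
       (auto simp: g_def f(2) trig_polys_zero trig_polys_add trig_polys_scale regular_borel_measure_sets[OF M]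
         intro: \<alpha> approximable_indicator[OF H countable M B] trig_polys_Lp_functions[OF M \<alpha>, THEN subsetD])
  show ?thesis
    unfolding approximable_def
  proof (intro conjI f(1) allI impI)
    fix \<epsilon> :: real assume "\<epsilon> > 0"
    then obtain p where p: "p \<in> trig_polys H" "(\<integral>\<gamma>. norm (g \<gamma> - p \<gamma>) powr \<alpha> \<partial>M) < \<epsilon>"
      using g unfolding approximable_def by blast
    have "norm (g \<gamma> - p \<gamma>) = norm (f \<gamma> - 1 * pairing \<gamma> x * p \<gamma>)" for \<gamma>
    proof -
      have "pairing \<gamma> x * (g \<gamma> - p \<gamma>) = (pairing \<gamma> x * cnj (pairing \<gamma> x)) * f \<gamma> - pairing \<gamma> x * p \<gamma>"
        by (simp only: g_def right_diff_distrib mult.assoc)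
      then have "norm (pairing \<gamma> x * (g \<gamma> - p \<gamma>)) = norm (f \<gamma> - 1 * pairing \<gamma> x * p \<gamma>)"
        by (simp only: pairing_mult_cnj mult_1)
      then show ?thesis by (simp add: norm_mult)
    qed
    moreover have "(\<lambda>\<gamma>. 1 * pairing \<gamma> x * p \<gamma>) \<in> trig_polys S"
      using p(1) by (rule trig_polys_mult_character) (auto simp: x)
    ultimately show "\<exists>p\<in>trig_polys S. (\<integral>\<gamma>. norm (f \<gamma> - p \<gamma>) powr \<alpha> \<partial>M) < \<epsilon>"
      using p(2) by (intro bexI[of _ "\<lambda>\<gamma>. 1 * pairing \<gamma> x * p \<gamma>"]) auto
  qed
qed

section \<open>Functions approximable along every coset\<close>

lemma approximable_imp_AE_limit:
  assumes f: "approximable \<alpha> M A f" and \<alpha>: "\<alpha> > 0" and A: "A \<subseteq> Lp_functions \<alpha> M"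
  obtains p where "\<And>n::nat. p n \<in> A" "AE x in M. (\<lambda>n. p n x) \<longlonglongrightarrow> f x"
proof -
  have "\<exists>p\<in>A. (\<integral>x. norm (f x - p x) powr \<alpha> \<partial>M) < 1 / Suc n" for n
    using f by (auto simp: approximable_def)
  then obtain p where p: "\<And>n. p n \<in> A" "\<And>n. (\<integral>x. norm (f x - p n x) powr \<alpha> \<partial>M) < 1 / Suc n"
    by metis
  have "(\<lambda>n. \<integral>x. norm (norm (f x - p n x) powr \<alpha>) \<partial>M) \<longlonglongrightarrow> 0"
  proof (rule tendsto_sandwich[OF _ _ tendsto_const])
    show "(\<lambda>n. 1 / real (Suc n)) \<longlonglongrightarrow> 0"
      using LIMSEQ_inverse_real_of_nat by (simp add: inverse_eq_divide)
    show "\<forall>\<^sub>F n in sequentially. (\<integral>x. norm (norm (f x - p n x) powr \<alpha>) \<partial>M) \<le> 1 / real (Suc n)"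
      using less_imp_le[OF p(2)] by (intro always_eventually allI) (simp del: of_nat_Suc)
  qed simp
  moreover have "integrable M (\<lambda>x. norm (f x - p n x) powr \<alpha>)" for n
    using f A p(1) \<alpha> by (intro integrable_Lp_functions Lp_functions_diff) (auto simp: approximable_def)
  ultimately obtain r :: "nat \<Rightarrow> nat" where r: "AE x in M. (\<lambda>n. norm (f x - p (r n) x) powr \<alpha>) \<longlonglongrightarrow> 0"
    using tendsto_L1_AE_subseq[of M "\<lambda>n x. norm (f x - p n x) powr \<alpha>"] by blast
  show thesis
  proof
    show "p (r n) \<in> A" for n by (rule p(1))
    from r show "AE x in M. (\<lambda>n. p (r n) x) \<longlonglongrightarrow> f x"
    proof eventually_elim
      case (elim x)
      have "(\<lambda>n. (norm (f x - p (r n) x) powr \<alpha>) powr (1 / \<alpha>)) \<longlonglongrightarrow> 0 powr (1 / \<alpha>)"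
        using \<alpha> by (intro tendsto_powr' elim tendsto_const) auto
      then have "(\<lambda>n. norm (p (r n) x - f x)) \<longlonglongrightarrow> 0"
        using \<alpha> by (simp add: powr_powr norm_minus_commute)
      then show ?case by (simp add: tendsto_norm_zero_iff LIM_zero_iff)
    qed
  qed
qed

text \<open>The translation rule of the polynomials survives in the limit at every pair \<open>\<gamma>\<close>, \<open>\<gamma> + \<kappa>\<close> of points
  at which an approximating sequence converges.\<close>

lemma approximable_coset_equivariant:
  assumes M: "regular_borel_measure M" and \<alpha>: "\<alpha> > 0"
    and f: "approximable \<alpha> M (trig_polys ((\<lambda>h. x + h) ` H)) f"
  obtains N where "N \<in> null_sets M"
    "\<And>\<gamma> \<kappa>. \<kappa> \<in> annihilator H \<Longrightarrow> \<gamma> \<notin> N \<Longrightarrow> \<gamma> + \<kappa> \<notin> N \<Longrightarrow> f (\<gamma> + \<kappa>) = pairing \<kappa> x * f \<gamma>"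
proof -
  obtain p where p: "\<And>n::nat. p n \<in> trig_polys ((\<lambda>h. x + h) ` H)"
      and lim: "AE \<gamma> in M. (\<lambda>n. p n \<gamma>) \<longlonglongrightarrow> f \<gamma>"
    using approximable_imp_AE_limit[OF f \<alpha> trig_polys_Lp_functions[OF M \<alpha>]] by blast
  from lim obtain N where N: "\<And>\<gamma>. \<gamma> \<in> space M - N \<Longrightarrow> (\<lambda>n. p n \<gamma>) \<longlonglongrightarrow> f \<gamma>" "N \<in> null_sets M"
    by (elim AE_E3) blast
  show thesis
  proof
    fix \<gamma> \<kappa> assume \<kappa>: "\<kappa> \<in> annihilator H" "\<gamma> \<notin> N" "\<gamma> + \<kappa> \<notin> N"
    have lim: "(\<lambda>n. p n (\<gamma> + \<kappa>)) \<longlonglongrightarrow> f (\<gamma> + \<kappa>)" "(\<lambda>n. p n \<gamma>) \<longlonglongrightarrow> f \<gamma>"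
      using N(1) \<kappa> regular_borel_measure_space[OF M] by auto
    have "p n (\<gamma> + \<kappa>) = pairing \<kappa> x * p n \<gamma>" for n
      by (rule trig_polys_coset_translate[OF p \<kappa>(1)])
    then have "(\<lambda>n. p n (\<gamma> + \<kappa>)) \<longlonglongrightarrow> pairing \<kappa> x * f \<gamma>"
      by (simp add: tendsto_mult_left lim(2))
    then show "f (\<gamma> + \<kappa>) = pairing \<kappa> x * f \<gamma>"
      by (rule LIMSEQ_unique[OF lim(1)])
  qed (rule N(2))
qed

text \<open>If \<open>\<gamma>\<close> and \<open>\<gamma> + \<kappa>\<close> both avoid the exceptional set \<open>Z\<close>, then
  \<open>f(\<gamma>) = f(\<gamma> + \<kappa>) = \<langle>\<kappa>, x\<rangle> f(\<gamma>)\<close> for some \<open>x\<close> with \<open>\<langle>\<kappa>, x\<rangle> \<noteq> 1\<close>, so both values are zero. Hence the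
  translates of \<open>N = {f \<noteq> 0} - Z\<close> are contained in \<open>Z\<close>. Countability of \<open>\<Lambda>\<close> makes \<open>Z\<close> null.\<close>

lemma approximable_all_cosets_support:
  fixes H :: "'a::topological_ab_group_add set"
  assumes countable: "countable (annihilator H)"
    and M: "regular_borel_measure M" and \<alpha>: "\<alpha> > 0"
    and f: "\<And>S. S \<in> cosets H \<Longrightarrow> approximable \<alpha> M (trig_polys S) f"
  obtains N where "translate_null (annihilator H) M N" "AE \<gamma> in M. \<gamma> \<notin> N \<longrightarrow> f \<gamma> = 0"
proof -
  have "\<exists>N\<in>null_sets M. \<forall>\<gamma> \<kappa>. \<kappa> \<in> annihilator H \<longrightarrow> \<gamma> \<notin> N \<longrightarrow> \<gamma> + \<kappa> \<notin> N \<longrightarrow>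
      f (\<gamma> + \<kappa>) = pairing \<kappa> x * f \<gamma>" for x
  proof -
    have "(\<lambda>h. x + h) ` H \<in> cosets H" by (auto simp: cosets_def)
    then obtain N where "N \<in> null_sets M" "\<And>\<gamma> \<kappa>. \<kappa> \<in> annihilator H \<Longrightarrow> \<gamma> \<notin> N \<Longrightarrow> \<gamma> + \<kappa> \<notin> N \<Longrightarrow>
        f (\<gamma> + \<kappa>) = pairing \<kappa> x * f \<gamma>"
      using approximable_coset_equivariant[OF M \<alpha> f] by blast
    then show ?thesis by blast
  qed
  then obtain E where E: "\<And>x. E x \<in> null_sets M"
      "\<And>x \<gamma> \<kappa>. \<kappa> \<in> annihilator H \<Longrightarrow> \<gamma> \<notin> E x \<Longrightarrow> \<gamma> + \<kappa> \<notin> E x \<Longrightarrow> f (\<gamma> + \<kappa>) = pairing \<kappa> x * f \<gamma>"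
    by metis
  have "\<exists>x. pairing \<kappa> x \<noteq> 1" if "\<kappa> \<noteq> 0" for \<kappa> :: "'a dual_group"
    using that dual_group_eqI[of \<kappa> 0] by auto
  then obtain X where X: "\<And>\<kappa> :: 'a dual_group. \<kappa> \<noteq> 0 \<Longrightarrow> pairing \<kappa> (X \<kappa>) \<noteq> 1" by metis
  define Z where "Z = E 0 \<union> (\<Union>\<kappa>\<in>annihilator H. E (X \<kappa>))"
  have Z: "Z \<in> null_sets M"
    unfolding Z_def using countable E(1) by (intro null_sets.Un null_sets_UN') auto
  have Zb: "Z \<in> sets borel"
    using Z null_setsD2 regular_borel_measure_sets[OF M] by blast
  have zero: "f (\<gamma> + \<kappa>) = 0" if "\<kappa> \<in> annihilator H - {0}" "\<gamma> \<notin> Z" "\<gamma> + \<kappa> \<notin> Z" for \<gamma> \<kappa>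
  proof -
    have "f (\<gamma> + \<kappa>) = pairing \<kappa> 0 * f \<gamma>"
      by (rule E(2)) (use that in \<open>auto simp: Z_def\<close>)
    moreover have "f (\<gamma> + \<kappa>) = pairing \<kappa> (X \<kappa>) * f \<gamma>"
      by (rule E(2)) (use that in \<open>auto simp: Z_def\<close>)
    ultimately show ?thesis using X[of \<kappa>] that(1) by auto
  qed
  define N where "N = {\<gamma>. f \<gamma> \<noteq> 0} - Z"
  have "f \<in> borel_measurable M"
  proof -
    have "(\<lambda>h. 0 + h) ` H \<in> cosets H" unfolding cosets_def by blast
    from f[OF this] show ?thesis by (simp add: approximable_def Lp_functions_def)
  qed
  then have "f \<in> borel_measurable borel"
    by (simp add: measurable_cong_sets[OF regular_borel_measure_sets[OF M] refl])
  then have "f -` (- {0}) \<inter> space borel \<in> sets borel"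
    by (rule measurable_sets) auto
  then have "{\<gamma>. f \<gamma> \<noteq> 0} \<in> sets borel" by (simp add: vimage_def)
  then have Nb: "N \<in> sets borel" using Zb unfolding N_def by (rule sets.Diff)
  have "(\<lambda>\<gamma>. \<gamma> + \<kappa>) -` N \<in> null_sets M" if "\<kappa> \<in> annihilator H - {0}" for \<kappa>
  proof (rule null_sets_subset[OF Z])
    show "(\<lambda>\<gamma>. \<gamma> + \<kappa>) -` N \<in> sets M"
      unfolding regular_borel_measure_sets[OF M] by (rule sets_borel_dual_group_translate[OF Nb])
    show "(\<lambda>\<gamma>. \<gamma> + \<kappa>) -` N \<subseteq> Z" using zero[OF that] by (auto simp: N_def)
  qed
  then have "translate_null (annihilator H) M N"
    using Nb by (simp add: translate_null_def)
  moreover have "AE \<gamma> in M. \<gamma> \<notin> N \<longrightarrow> f \<gamma> = 0"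
    using AE_not_in[OF Z] by eventually_elim (auto simp: N_def)
  ultimately show thesis by (rule that)
qed

text \<open>Stated for any regular measure and any largest set \<open>B\<close> with null translates; besides the intersection
  formula of the theorem it also gives regularity of the regular part, where \<open>B = {}\<close>.\<close>

lemma Inter_Lp_closure_trig_polys:
  fixes M :: "'g::{topological_ab_group_add, t2_space} dual_group measure"
  assumes H: "closed_subgroup H" and countable: "countable (annihilator H)"
    and M: "regular_borel_measure M" and B: "translate_null (annihilator H) M B"
    and largest: "\<And>N. translate_null (annihilator H) M N \<Longrightarrow> N - B \<in> null_sets M"
    and \<alpha>: "\<alpha> > 0"
  shows "(\<Inter>S\<in>cosets H. Lp_closure \<alpha> M (trig_polys S)) =
    {ae_rel M `` {f} | f. f \<in> Lp_functions \<alpha> M \<and> (\<forall>\<gamma>. \<gamma> \<notin> B \<longrightarrow> f \<gamma> = 0)}" (is "?L = ?R")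
proof
  have closure: "Lp_closure \<alpha> M (trig_polys S) = {ae_rel M `` {f} | f. approximable \<alpha> M (trig_polys S) f}" for S
    by (rule Lp_closure_eq[OF \<alpha> trig_polys_Lp_functions[OF M \<alpha>]])
  show "?R \<subseteq> ?L"
  proof (rule subsetI, rule INT_I)
    fix F S assume "F \<in> ?R" and S: "S \<in> cosets H"
    from \<open>F \<in> ?R\<close> obtain f where f: "F = ae_rel M `` {f}" "f \<in> Lp_functions \<alpha> M" "\<forall>\<gamma>. \<gamma> \<notin> B \<longrightarrow> f \<gamma> = 0"
      by (elim CollectE exE conjE)
    have ap: "approximable \<alpha> M (trig_polys S) f"
      by (rule approximable_coset_of_supported[OF H countable M B S \<alpha> f(2)]) (simp add: f(3))
    show "F \<in> Lp_closure \<alpha> M (trig_polys S)"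
      unfolding closure f(1) by (rule CollectI, rule exI[of _ f], rule conjI[OF refl ap])
  qed
  show "?L \<subseteq> ?R"
  proof
    fix F assume F: "F \<in> ?L"
    have rep: "\<exists>f. F = ae_rel M `` {f} \<and> approximable \<alpha> M (trig_polys S) f" if "S \<in> cosets H" for S
      using INT_D[OF F that] unfolding closure by (rule CollectD)
    have "(\<lambda>h. 0 + h) ` H \<in> cosets H" unfolding cosets_def by blast
    then obtain f where f: "F = ae_rel M `` {f}" "f \<in> Lp_functions \<alpha> M"
      using rep approximable_def by metis
    have fm: "f \<in> borel_measurable M" using f(2) by (rule Lp_functions_measurable)
    have approx: "approximable \<alpha> M (trig_polys S) f" if "S \<in> cosets H" for S
    proof -
      obtain g where g: "F = ae_rel M `` {g}" "approximable \<alpha> M (trig_polys S) g"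
        using rep[OF \<open>S \<in> cosets H\<close>] by (elim exE conjE)
      have "(g, f) \<in> ae_rel M"
        using g(1) f(1) by (intro eq_equiv_class[OF _ equiv_ae_rel fm]) simp
      then show ?thesis
        by (rule approximable_AE_cong[OF g(2) _ trig_polys_Lp_functions[OF M \<alpha>]])
    qed
    obtain N where N: "translate_null (annihilator H) M N" "AE \<gamma> in M. \<gamma> \<notin> N \<longrightarrow> f \<gamma> = 0"
      by (rule approximable_all_cosets_support[OF countable M \<alpha> approx])
    have Bm: "B \<in> sets M"
      using B unfolding translate_null_def regular_borel_measure_sets[OF M] by blast
    define g where "g \<gamma> = indicator B \<gamma> * f \<gamma>" for \<gamma>
    have gm: "g \<in> borel_measurable M"
      unfolding g_def using Bm fm by measurable
    have ae: "AE \<gamma> in M. f \<gamma> = g \<gamma>"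
      using N(2) AE_not_in[OF largest[OF N(1)]] by eventually_elim (auto simp: g_def indicator_def)
    have fg: "(f, g) \<in> ae_rel M"
      unfolding ae_rel_def by (rule CollectI, rule case_prodI, intro conjI fm gm ae)
    have gLp: "g \<in> Lp_functions \<alpha> M"
      unfolding g_def by (rule Lp_functions_indicator[OF Bm f(2)])
    have gB: "\<forall>\<gamma>. \<gamma> \<notin> B \<longrightarrow> g \<gamma> = 0" by (simp add: g_def)
    have "F = ae_rel M `` {g}"
      unfolding f(1) by (rule equiv_class_eq[OF equiv_ae_rel fg])
    then show "F \<in> ?R"
      by (intro CollectI exI[of _ g] conjI gLp gB)
  qed
qed

section \<open>The regular and the singular part\<close>

text \<open>The set \<open>B\<close> still has null translates for the restricted measure and now carries all of its mass, so
  every element of \<open>L\<^sup>\<alpha>\<close> is represented by a function supported in \<open>B\<close>.\<close>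

lemma H_singular_restrict:
  fixes M :: "'g::{topological_ab_group_add, t2_space} dual_group measure"
  assumes H: "closed_subgroup H" and countable: "countable (annihilator H)"
    and M: "regular_borel_measure M" and B: "translate_null (annihilator H) M B"
  shows "H_singular H (density M (indicator B))"
  unfolding H_singular_def
proof (intro allI impI ballI)
  let ?N = "density M (indicator B)"
  fix \<alpha> :: real and S assume \<alpha>: "\<alpha> > 0" and S: "S \<in> cosets H"
  note sets = regular_borel_measure_sets[OF M]
  have Bb: "B \<in> sets borel" and Bm: "B \<in> sets M"
    using B unfolding translate_null_def sets by blast+
  have N: "regular_borel_measure ?N" by (rule regular_borel_measure_restrict[OF M Bb])
  have BN: "translate_null (annihilator H) ?N B"
    unfolding translate_null_def
  proof (intro conjI Bb ballI)
    fix \<kappa> assume \<kappa>: "\<kappa> \<in> annihilator H - {0}"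
    then have null: "(\<lambda>\<gamma>. \<gamma> + \<kappa>) -` B \<in> null_sets M" using B unfolding translate_null_def by blast
    then show "(\<lambda>\<gamma>. \<gamma> + \<kappa>) -` B \<in> null_sets ?N"
      using null_sets_restrict_iff[OF Bm null_setsD2[OF null]] null_set_Int1[OF null Bm] by blast
  qed
  have closure: "Lp_closure \<alpha> ?N (trig_polys S) = {ae_rel ?N `` {f} | f. approximable \<alpha> ?N (trig_polys S) f}"
    by (rule Lp_closure_eq[OF \<alpha> trig_polys_Lp_functions[OF N \<alpha>]])
  have "approximable \<alpha> ?N (trig_polys S) f" if f: "f \<in> Lp_functions \<alpha> ?N" for f
  proof -
    let ?g = "\<lambda>\<gamma>. indicator B \<gamma> * f \<gamma>"
    have fm: "f \<in> borel_measurable M" using Lp_functions_measurable[OF f] by simp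
    have gm: "?g \<in> borel_measurable M" using Bm fm by measurable
    have "approximable \<alpha> ?N (trig_polys S) ?g"
      by (rule approximable_coset_of_supported[OF H countable N BN S \<alpha> Lp_functions_indicator[OF _ f]])
         (simp_all add: Bm)
    moreover have "(?g, f) \<in> ae_rel ?N"
      by (rule iffD2[OF ae_rel_restrict_iff[OF Bm gm fm]]) (use Bm fm in \<open>auto simp: ae_rel_def indicator_def\<close>)
    ultimately show ?thesis
      by (rule approximable_AE_cong[OF _ _ trig_polys_Lp_functions[OF N \<alpha>]])
  qed
  then show "Lp_closure \<alpha> ?N (trig_polys S) = Lp \<alpha> ?N"
    unfolding closure Lp_eq_classes approximable_def by blast
qed

text \<open>Let \<open>A\<close> have null translates for the restriction of \<open>M\<close> to the complement of \<open>B\<close>. Its translates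
  could still meet \<open>B\<close> in positive mass, but only through points in the translates of \<open>B\<close>, which are null.
  Removing \<open>B\<close> and these translates leaves a set with null translates for \<open>M\<close> itself, which is null by
  maximality of \<open>B\<close>. So \<open>A\<close> is null for the restriction, and the empty set is a largest set with null
  translates there.\<close>

lemma H_regular_restrict:
  fixes M :: "'g::{topological_ab_group_add, t2_space} dual_group measure"
  assumes H: "closed_subgroup H" and countable: "countable (annihilator H)"
    and M: "regular_borel_measure M" and B: "translate_null (annihilator H) M B"
    and largest: "\<And>N. translate_null (annihilator H) M N \<Longrightarrow> N - B \<in> null_sets M"
  shows "H_regular H (density M (indicator (- B)))"
  unfolding H_regular_def
proof (intro allI impI)
  let ?N = "density M (indicator (- B))"
  fix \<alpha> :: real assume \<alpha>: "\<alpha> > 0"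
  note sets = regular_borel_measure_sets[OF M]
  have Bb: "B \<in> sets borel" using B unfolding translate_null_def by (rule conjunct1)
  then have Cb: "- B \<in> sets borel" by (rule borel_comp)
  then have Cm: "- B \<in> sets M" unfolding sets .
  have N: "regular_borel_measure ?N" by (rule regular_borel_measure_restrict[OF M Cb])
  define Z where "Z = (\<Union>\<kappa>\<in>annihilator H - {0}. (\<lambda>\<gamma>. \<gamma> + - \<kappa>) -` B)"
  have "(\<lambda>\<gamma>. \<gamma> + - \<kappa>) -` B \<in> null_sets M" if "\<kappa> \<in> annihilator H - {0}" for \<kappa>
  proof -
    have "- \<kappa> \<in> annihilator H - {0}" using that by (auto simp: annihilator_def)
    then show ?thesis using B unfolding translate_null_def by blast
  qed
  then have Z: "Z \<in> null_sets M"
    unfolding Z_def using countable by (intro null_sets_UN') auto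
  have Zb: "Z \<in> sets borel" using null_setsD2[OF Z] unfolding sets .
  have null: "A - {} \<in> null_sets ?N" if A: "translate_null (annihilator H) ?N A" for A
  proof -
    have Ab: "A \<in> sets borel" using A unfolding translate_null_def by (rule conjunct1)
    then have Am: "A \<in> sets M" unfolding sets .
    define A' where "A' = A - B - Z"
    have A'b: "A' \<in> sets borel"
      unfolding A'_def by (intro sets.Diff Ab Bb Zb)
    have "(\<lambda>\<gamma>. \<gamma> + \<kappa>) -` A' \<in> null_sets M" if \<kappa>: "\<kappa> \<in> annihilator H - {0}" for \<kappa>
    proof (rule null_sets_subset)
      have "(\<lambda>\<gamma>. \<gamma> + \<kappa>) -` A \<in> null_sets ?N" using A \<kappa> unfolding translate_null_def by blast
      then show "- B \<inter> (\<lambda>\<gamma>. \<gamma> + \<kappa>) -` A \<in> null_sets M"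
        using null_sets_restrict_iff[OF Cm, of "(\<lambda>\<gamma>. \<gamma> + \<kappa>) -` A"] sets_borel_dual_group_translate[OF Ab]
        unfolding sets by blast
      show "(\<lambda>\<gamma>. \<gamma> + \<kappa>) -` A' \<in> sets M"
        unfolding sets by (rule sets_borel_dual_group_translate[OF A'b])
      have "\<gamma> + \<kappa> \<in> Z" if "\<gamma> \<in> B" for \<gamma>
      proof -
        have "\<gamma> + \<kappa> + - \<kappa> \<in> B" using that by simp
        then show ?thesis unfolding Z_def using \<kappa> by blast
      qed
      then show "(\<lambda>\<gamma>. \<gamma> + \<kappa>) -` A' \<subseteq> - B \<inter> (\<lambda>\<gamma>. \<gamma> + \<kappa>) -` A"
        by (auto simp: A'_def)
    qed
    then have "translate_null (annihilator H) M A'"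
      unfolding translate_null_def using A'b by blast
    then have "(A' - B) \<union> Z \<in> null_sets M" using largest Z by (intro null_sets.Un)
    moreover have "- B \<inter> A \<in> sets M" using Cm Am by (rule sets.Int)
    moreover have "- B \<inter> A \<subseteq> (A' - B) \<union> Z" by (auto simp: A'_def)
    ultimately have "- B \<inter> A \<in> null_sets M" by (rule null_sets_subset)
    then show ?thesis by (simp add: null_sets_restrict_iff[OF Cm Am])
  qed
  have "(\<Inter>S\<in>cosets H. Lp_closure \<alpha> ?N (trig_polys S)) =
      {ae_rel ?N `` {f} | f. f \<in> Lp_functions \<alpha> ?N \<and> (\<forall>\<gamma>. \<gamma> \<notin> {} \<longrightarrow> f \<gamma> = 0)}"
    by (rule Inter_Lp_closure_trig_polys[OF H countable N _ null \<alpha>]) (simp add: translate_null_def)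
  also have "\<dots> = {ae_rel ?N `` {f} | f. f = (\<lambda>_. 0)}"
  proof -
    have "(\<lambda>_. 0) \<in> Lp_functions \<alpha> ?N" by (simp add: Lp_functions_def)
    then have "f \<in> Lp_functions \<alpha> ?N \<and> (\<forall>\<gamma>. \<gamma> \<notin> {} \<longrightarrow> f \<gamma> = 0) \<longleftrightarrow> f = (\<lambda>_. 0)" for f
      by (auto simp: fun_eq_iff[symmetric])
    then show ?thesis by (simp only:)
  qed
  also have "\<dots> = {Lp_zero ?N}" unfolding Lp_zero_def by blast
  finally show "(\<Inter>S\<in>cosets H. Lp_closure \<alpha> ?N (trig_polys S)) = {Lp_zero ?N}" .
qed

theorem theorem2p3:
  fixes H :: "'g::{topological_ab_group_add, t2_space} set"
    and \<mu> :: "'g dual_group measure"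
  assumes "locally_compact_space (euclidean :: 'g topology)"
    and "closed_subgroup H"
    and "countable (annihilator H)"
    and "regular_borel_measure \<mu>"
  shows "\<exists>\<mu>\<^sub>\<rho> \<mu>\<^sub>\<sigma> B\<^sub>\<rho> B\<^sub>\<sigma>.
    regular_borel_measure \<mu>\<^sub>\<rho> \<and> regular_borel_measure \<mu>\<^sub>\<sigma> \<and>
    (\<forall>B\<in>sets borel. emeasure \<mu> B = emeasure \<mu>\<^sub>\<rho> B + emeasure \<mu>\<^sub>\<sigma> B) \<and>
    H_regular H \<mu>\<^sub>\<rho> \<and> H_singular H \<mu>\<^sub>\<sigma> \<and>
    B\<^sub>\<rho> \<in> sets borel \<and> B\<^sub>\<sigma> \<in> sets borel \<and>
    (\<forall>\<alpha>>0.
       Lp_identified \<alpha> \<mu>\<^sub>\<rho> \<mu> B\<^sub>\<rho> \<and> Lp_identified \<alpha> \<mu>\<^sub>\<sigma> \<mu> B\<^sub>\<sigma> \<and>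
       Lp_direct_sum \<mu> (Lp \<alpha> \<mu>)
         (Lp_indicator \<mu> B\<^sub>\<rho> ` Lp \<alpha> \<mu>\<^sub>\<rho>) (Lp_indicator \<mu> B\<^sub>\<sigma> ` Lp \<alpha> \<mu>\<^sub>\<sigma>) \<and>
       Lp_indicator \<mu> B\<^sub>\<sigma> ` Lp \<alpha> \<mu>\<^sub>\<sigma> =
         (\<Inter>S\<in>cosets H. Lp_closure \<alpha> \<mu> (trig_polys S)))"
proof -
  note H = assms(2) and countable = assms(3) and \<mu> = assms(4)
  note sets = regular_borel_measure_sets[OF \<mu>]
  obtain B where B: "translate_null (annihilator H) \<mu> B"
      and B': "\<forall>N. translate_null (annihilator H) \<mu> N \<longrightarrow> N - B \<in> null_sets \<mu>"
    by (rule exists_largest_translate_null[OF regular_borel_measure_finite[OF \<mu>] sets, of "annihilator H"])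
  have largest: "N - B \<in> null_sets \<mu>" if "translate_null (annihilator H) \<mu> N" for N
    using B' that by blast
  have Bb: "B \<in> sets borel" using B unfolding translate_null_def by (rule conjunct1)
  then have Cb: "- B \<in> sets borel" by (rule borel_comp)
  have Bm: "B \<in> sets \<mu>" "- B \<in> sets \<mu>" unfolding sets by (rule Bb, rule Cb)
  have sum: "emeasure \<mu> A = emeasure (density \<mu> (indicator (- B))) A + emeasure (density \<mu> (indicator B)) A"
    if "A \<in> sets borel" for A
  proof -
    have Am: "A \<in> sets \<mu>" unfolding sets by (rule that)
    have "emeasure \<mu> (- B \<inter> A) + emeasure \<mu> (B \<inter> A) = emeasure \<mu> ((- B \<inter> A) \<union> (B \<inter> A))"
      using Am Bm by (intro plus_emeasure sets.Int) auto
    also have "(- B \<inter> A) \<union> (B \<inter> A) = A" by blast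
    finally show ?thesis by (simp add: emeasure_restricted[OF _ Am] Bm)
  qed
  have "Lp_indicator \<mu> B ` Lp \<alpha> (density \<mu> (indicator B)) =
      (\<Inter>S\<in>cosets H. Lp_closure \<alpha> \<mu> (trig_polys S))" if "\<alpha> > 0" for \<alpha>
    unfolding Lp_indicator_image(1)[OF Bm(1)]
    by (rule Inter_Lp_closure_trig_polys[OF H countable \<mu> B largest that, symmetric])
  then show ?thesis
    by (intro exI[of _ "density \<mu> (indicator (- B))"] exI[of _ "density \<mu> (indicator B)"]
          exI[of _ "- B"] exI[of _ B] conjI allI impI ballI sum Bb Cb
          regular_borel_measure_restrict[OF \<mu>] H_regular_restrict[OF H countable \<mu> B largest]
          H_singular_restrict[OF H countable \<mu> B] Lp_identified_restrict Bm
          Lp_direct_sum_restrict regular_borel_measure_space[OF \<mu>])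
qed

end
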